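(* A directed $st$-graph $G$ is vulnerable if and only if $G$ has an acyclic subgraph $H$ that is weak.
   Context: A directed $st$-graph $G=(V,E,s,t)$ is a finite directed graph with no self-loops and no parallel edges, with distinct source $s$ (no incoming edges) and sink $t$ (no outgoing edges), such that every vertex lies on some directed walk from $s$ to $t$. Subgraphs $H$ are taken with the same source $s$ and sink $t$ and are themselves directed $st$-graphs (every vertex of $H$ lies on an $s$–$t$ walk of $H$). Weakness: a channel is $\eta:V\to\mathbb{N}\cup\{\infty\}$ with $\eta(s)=\eta(t)=\infty$; a flow for $\eta$ is a finitely supported $\phi$ from $s$–$t$ walks to $\mathbb{N}$ with $\sum_p m_v(p)\phi(p)\le\eta(v)$ ($m_v(p)$ = occurrences of $v$ in $p$), of value $\sum_p\phi(p)$; $\max_\eta$ is the maximum value; $\phi$ inhibits $\eta$ if the residual charges $\eta(v)-\sum_p m_v(p)\phi(p)$ admit no flow of positive value; $\min_\eta$ is the minimum value of an inhibiting flow; a graph is weak if $\min_\eta\neq\max_\eta$ for some $\eta$. Vulnerability: a flow is a finitely supported $\varphi\ge0$ on $s$–$t$ walks inducing $\varphi(e)=\sum_p(\text{occurrences of }e\text{ in }p)\varphi(p)$; a latency function assigns each edge a continuous non-decreasing $l_e:\mathbb{R}_{\ge0}\to\mathbb{R}_{\ge0}$, $l_p(\varphi)=\sum_{e\in p}l_e(\varphi(e))$; $\varphi$ of total value $r$ is a Wardrop flow for $(G,r,l)$ if $l_p(\varphi)\le l_q(\varphi)$ whenever $\varphi(p)>0$; $L(G,r,l)$ is the common latency of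 used paths ($0$ if $r=0$); $G$ is vulnerable if $L(G,r,l)>L(H,r,l|_H)$ for some $r$, $l$, subgraph $H$. *)

theory Defs
  imports "HOL-Analysis.Analysis" "HOL-Library.Extended_Nat"
begin

text \<open>A directed graph is given by a vertex set V and an edge relation E (a set of
  ordered pairs, so there are no parallel edges). Walks are nonempty vertex lists
  whose consecutive entries are edges.\<close>

definition st_walks :: "('v \<times> 'v) set \<Rightarrow> 'v \<Rightarrow> 'v \<Rightarrow> 'v list set" where
  "st_walks E s t = {p. p \<noteq> [] \<and> hd p = s \<and> last p = t \<and> successively (\<lambda>x y. (x, y) \<in> E) p}"

definition st_graph :: "'v set \<Rightarrow> ('v \<times> 'v) set \<Rightarrow> 'v \<Rightarrow> 'v \<Rightarrow> bool" where
  "st_graph V E s t \<longleftrightarrow>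
     finite V \<and> E \<subseteq> V \<times> V \<and> (\<forall>v. (v, v) \<notin> E) \<and>
     s \<in> V \<and> t \<in> V \<and> s \<noteq> t \<and>
     (\<forall>u. (u, s) \<notin> E) \<and> (\<forall>w. (t, w) \<notin> E) \<and>
     (\<forall>v\<in>V. \<exists>p\<in>st_walks E s t. v \<in> set p)"

definition st_subgraph :: "'v set \<Rightarrow> ('v \<times> 'v) set \<Rightarrow> 'v set \<Rightarrow> ('v \<times> 'v) set \<Rightarrow> 'v \<Rightarrow> 'v \<Rightarrow> bool" where
  "st_subgraph V E V' E' s t \<longleftrightarrow> V' \<subseteq> V \<and> E' \<subseteq> E \<and> st_graph V' E' s t"

definition supp :: "('a \<Rightarrow> 'b::zero) \<Rightarrow> 'a set" where
  "supp f = {x. f x \<noteq> 0}"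

definition channel :: "'v \<Rightarrow> 'v \<Rightarrow> ('v \<Rightarrow> enat) \<Rightarrow> bool" where
  "channel s t \<eta> \<longleftrightarrow> \<eta> s = \<infinity> \<and> \<eta> t = \<infinity>"

definition vload :: "('v list \<Rightarrow> nat) \<Rightarrow> 'v \<Rightarrow> nat" where
  "vload \<phi> v = (\<Sum>p\<in>supp \<phi>. count_list p v * \<phi> p)"

definition nflow_value :: "('v list \<Rightarrow> nat) \<Rightarrow> nat" where
  "nflow_value \<phi> = (\<Sum>p\<in>supp \<phi>. \<phi> p)"

definition nflow :: "('v \<times> 'v) set \<Rightarrow> 'v \<Rightarrow> 'v \<Rightarrow> ('v \<Rightarrow> enat) \<Rightarrow> ('v list \<Rightarrow> nat) \<Rightarrow> bool" where
  "nflow E s t \<eta> \<phi> \<longleftrightarrow>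
     finite (supp \<phi>) \<and> supp \<phi> \<subseteq> st_walks E s t \<and> (\<forall>v. enat (vload \<phi> v) \<le> \<eta> v)"

definition residual :: "('v \<Rightarrow> enat) \<Rightarrow> ('v list \<Rightarrow> nat) \<Rightarrow> 'v \<Rightarrow> enat" where
  "residual \<eta> \<phi> v = \<eta> v - enat (vload \<phi> v)"

definition inhibits :: "('v \<times> 'v) set \<Rightarrow> 'v \<Rightarrow> 'v \<Rightarrow> ('v \<Rightarrow> enat) \<Rightarrow> ('v list \<Rightarrow> nat) \<Rightarrow> bool" where
  "inhibits E s t \<eta> \<phi> \<longleftrightarrow>
     nflow E s t \<eta> \<phi> \<and> \<not> (\<exists>\<psi>. nflow E s t (residual \<eta> \<phi>) \<psi> \<and> nflow_value \<psi> > 0)"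

definition max_flow :: "('v \<times> 'v) set \<Rightarrow> 'v \<Rightarrow> 'v \<Rightarrow> ('v \<Rightarrow> enat) \<Rightarrow> enat" where
  "max_flow E s t \<eta> = Sup {enat (nflow_value \<phi>) | \<phi>. nflow E s t \<eta> \<phi>}"

definition min_inhibiting :: "('v \<times> 'v) set \<Rightarrow> 'v \<Rightarrow> 'v \<Rightarrow> ('v \<Rightarrow> enat) \<Rightarrow> enat" where
  "min_inhibiting E s t \<eta> = Inf {enat (nflow_value \<phi>) | \<phi>. inhibits E s t \<eta> \<phi>}"

definition weak :: "('v \<times> 'v) set \<Rightarrow> 'v \<Rightarrow> 'v \<Rightarrow> bool" where
  "weak E s t \<longleftrightarrow> (\<exists>\<eta>. channel s t \<eta> \<and> min_inhibiting E s t \<eta> \<noteq> max_flow E s t \<eta>)"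

definition walk_edges :: "'v list \<Rightarrow> ('v \<times> 'v) list" where
  "walk_edges p = zip p (tl p)"

definition rflow :: "('v \<times> 'v) set \<Rightarrow> 'v \<Rightarrow> 'v \<Rightarrow> ('v list \<Rightarrow> real) \<Rightarrow> bool" where
  "rflow E s t \<phi> \<longleftrightarrow> finite (supp \<phi>) \<and> supp \<phi> \<subseteq> st_walks E s t \<and> (\<forall>p. 0 \<le> \<phi> p)"

definition rflow_value :: "('v list \<Rightarrow> real) \<Rightarrow> real" where
  "rflow_value \<phi> = (\<Sum>p\<in>supp \<phi>. \<phi> p)"

definition edge_flow :: "('v list \<Rightarrow> real) \<Rightarrow> 'v \<times> 'v \<Rightarrow> real" where
  "edge_flow \<phi> e = (\<Sum>p\<in>supp \<phi>. real (count_list (walk_edges p) e) * \<phi> p)"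

definition latency_fun :: "('v \<times> 'v) set \<Rightarrow> ('v \<times> 'v \<Rightarrow> real \<Rightarrow> real) \<Rightarrow> bool" where
  "latency_fun E l \<longleftrightarrow>
     (\<forall>e\<in>E. continuous_on {0..} (l e) \<and> mono_on {0..} (l e) \<and> (\<forall>x\<ge>0. 0 \<le> l e x))"

definition path_latency :: "('v \<times> 'v \<Rightarrow> real \<Rightarrow> real) \<Rightarrow> ('v list \<Rightarrow> real) \<Rightarrow> 'v list \<Rightarrow> real" where
  "path_latency l \<phi> p = sum_list (map (\<lambda>e. l e (edge_flow \<phi> e)) (walk_edges p))"

definition wardrop :: "('v \<times> 'v) set \<Rightarrow> 'v \<Rightarrow> 'v \<Rightarrow> real \<Rightarrow> ('v \<times> 'v \<Rightarrow> real \<Rightarrow> real) \<Rightarrow> ('v list \<Rightarrow> real) \<Rightarrow> bool" where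
  "wardrop E s t r l \<phi> \<longleftrightarrow>
     rflow E s t \<phi> \<and> rflow_value \<phi> = r \<and>
     (\<forall>p\<in>st_walks E s t. \<forall>q\<in>st_walks E s t. \<phi> p > 0 \<longrightarrow> path_latency l \<phi> p \<le> path_latency l \<phi> q)"

definition eq_latency :: "('v \<times> 'v) set \<Rightarrow> 'v \<Rightarrow> 'v \<Rightarrow> real \<Rightarrow> ('v \<times> 'v \<Rightarrow> real \<Rightarrow> real) \<Rightarrow> real" where
  "eq_latency E s t r l =
     (if r = 0 then 0
      else (THE c. \<exists>\<phi> p. wardrop E s t r l \<phi> \<and> \<phi> p > 0 \<and> path_latency l \<phi> p = c))"

definition vulnerable :: "'v set \<Rightarrow> ('v \<times> 'v) set \<Rightarrow> 'v \<Rightarrow> 'v \<Rightarrow> bool" where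
  "vulnerable V E s t \<longleftrightarrow>
     (\<exists>r l V' E'. r \<ge> 0 \<and> latency_fun E l \<and> st_subgraph V E V' E' s t \<and>
        eq_latency E s t r l > eq_latency E' s t r l)"

end

theory Submission
  imports Defs "HOL-Library.Multiset"
begin

text \<open>Both properties amount to the presence of a subdivided Wheatstone network. On such a network,
  Braess's latencies show vulnerability, and unit charges at the two ends of the middle path show
  weakness. Conversely, let f be an inhibiting flow and g a larger flow (weakness), or f an
  equilibrium flow of G and g an equilibrium flow of smaller latency in a subgraph (vulnerability).
  There is a cut all of whose vertices are saturated by f, or all of whose edges carry more of f
  than of g. By minimality every element of the cut lies on a walk meeting the cut only there,
  while by comparing the flows some path p of f meets the cut twice, first in \<alpha> and then in
  \<beta>. A walk from \<alpha> to t and one from s to \<beta> that avoid the rest of the cut cannot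
  meet. They bypass p in a way that forces two overlapping detours of p, and p together with these is
  a Wheatstone network.\<close>

section \<open>Walks\<close>

text \<open>Weakness limits vertex loads and vulnerability compares edge flows, so the cut consists
  of vertices in one argument and of edges in the other. Two walks that met could be spliced into an
  s-t walk missing the cut; this is the source of their disjointness. They are not yet detours: each
  may leave and rejoin p many times and in any order. The combinatorial core therefore uses only
  disjointness and extracts excursions whose ends interleave along p. Repeated vertices are the
  second obstacle, because bounding how often a walk passes a cut requires simple walks. Acyclicity
  of the subgraph supplies this for weakness; an equilibrium supported on simple paths supplies it
  for vulnerability, where G may contain cycles. In the opposite direction G may contain many walks
  outside the network. For weakness they are discarded by passing to the union of three paths. For
  vulnerability the equilibrium of G must be tested against all of them, which is why the latencies
  are derived from a potential.\<close>

lemma walk_edges_simps [simp]: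
  "walk_edges [] = []"
  "walk_edges [x] = []"
  "walk_edges (x # y # zs) = (x, y) # walk_edges (y # zs)"
  by (simp_all add: walk_edges_def)

lemma walk_edges_append:
  "walk_edges (xs @ v # ys) = walk_edges (xs @ [v]) @ walk_edges (v # ys)"
proof (induction xs)
  case (Cons x xs)
  then show ?case by (cases xs) auto
qed simp

lemma walk_edges_append2:
  "walk_edges (xs @ u # v # ys) = walk_edges (xs @ [u]) @ (u, v) # walk_edges (v # ys)"
  by (subst walk_edges_append) simp

lemma successively_iff_walk_edges:
  "successively (\<lambda>x y. (x, y) \<in> E) p \<longleftrightarrow> set (walk_edges p) \<subseteq> E"
  by (induction p rule: induct_list012) auto

lemma st_walks_iff:
  "p \<in> st_walks E s t \<longleftrightarrow> p \<noteq> [] \<and> hd p = s \<and> last p = t \<and> set (walk_edges p) \<subseteq> E"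
  by (simp add: st_walks_def successively_iff_walk_edges)

lemma st_walks_mono: "E \<subseteq> E' \<Longrightarrow> st_walks E s t \<subseteq> st_walks E' s t"
  unfolding st_walks_iff subset_iff by blast

lemma in_walk_edges_iff:
  "(u, v) \<in> set (walk_edges p) \<longleftrightarrow> (\<exists>xs ys. p = xs @ u # v # ys)"
proof
  assume "(u, v) \<in> set (walk_edges p)"
  then show "\<exists>xs ys. p = xs @ u # v # ys"
  proof (induction p rule: induct_list012)
    case (3 x y zs)
    then show ?case
      by (metis append_Cons append_Nil prod.inject set_ConsD walk_edges_simps(3))
  qed auto
qed (auto simp: walk_edges_append2)

lemma walk_edges_subset: "set (walk_edges p) \<subseteq> set p \<times> set p"
  by (auto simp: in_walk_edges_iff)

lemma distinct_walk_edges: "distinct p \<Longrightarrow> distinct (walk_edges p)"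
  by (simp add: walk_edges_def distinct_zipI1)

text \<open>At a shared vertex the start of one walk can be continued by the end of another. Spliced
  walks of this kind are what contradicts a cut.\<close>

lemma walk_splice_edges:
  "set (walk_edges (xs @ v # ys)) \<subseteq> E \<Longrightarrow> set (walk_edges (xs' @ v # ys')) \<subseteq> E \<Longrightarrow>
   set (walk_edges (xs @ v # ys')) \<subseteq> E"
  by (subst (asm) (1 2) walk_edges_append, subst walk_edges_append) auto

text \<open>Cutting out a closed piece between two visits of a vertex keeps the ends and shortens
  the walk. The edges are compared as multisets because latencies count every traversal of an
  edge.\<close>

lemma loop_erasure:
  assumes "p \<noteq> []"
  obtains q where "distinct q" "q \<noteq> []" "hd q = hd p" "last q = last p"
    "set q \<subseteq> set p" "mset (walk_edges q) \<subseteq># mset (walk_edges p)"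
proof -
  have "\<exists>q. distinct q \<and> q \<noteq> [] \<and> hd q = hd p \<and> last q = last p \<and>
    set q \<subseteq> set p \<and> mset (walk_edges q) \<subseteq># mset (walk_edges p)"
    using assms
  proof (induction p rule: length_induct)
    case (1 p)
    show ?case
    proof (cases "distinct p")
      case True
      with 1 show ?thesis by blast
    next
      case False
      then obtain xs y ys zs where p: "p = xs @ [y] @ ys @ [y] @ zs"
        using not_distinct_decomp by blast
      let ?p = "xs @ y # zs"
      have "walk_edges p = walk_edges (xs @ [y]) @ walk_edges (y # ys @ [y]) @ walk_edges (y # zs)"
        unfolding p using walk_edges_append[of xs y "ys @ [y] @ zs"]
          walk_edges_append[of "y # ys" y zs] by simp
      moreover have "walk_edges ?p = walk_edges (xs @ [y]) @ walk_edges (y # zs)"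
        by (rule walk_edges_append)
      ultimately have sub: "mset (walk_edges ?p) \<subseteq># mset (walk_edges p)" by simp
      have "length ?p < length p" "?p \<noteq> []" by (simp_all add: p)
      with 1 obtain q where q: "distinct q" "q \<noteq> []" "hd q = hd ?p" "last q = last ?p"
        "set q \<subseteq> set ?p" "mset (walk_edges q) \<subseteq># mset (walk_edges ?p)"
        by blast
      have "hd ?p = hd p" "last ?p = last p" "set ?p \<subseteq> set p"
        unfolding p by (cases xs; simp) auto
      with q sub show ?thesis
        by (metis order_trans subset_mset.order_trans)
    qed
  qed
  with that show ?thesis by blast
qed

lemma st_walk_loop_erasure:
  assumes "p \<in> st_walks E s t"
  obtains q where "distinct q" "q \<in> st_walks E s t"
    "set q \<subseteq> set p" "mset (walk_edges q) \<subseteq># mset (walk_edges p)"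
proof -
  have "p \<noteq> []" using assms by (simp add: st_walks_iff)
  then obtain q where q: "distinct q" "q \<noteq> []" "hd q = hd p" "last q = last p"
    "set q \<subseteq> set p" "mset (walk_edges q) \<subseteq># mset (walk_edges p)"
    by (rule loop_erasure)
  have "set (walk_edges q) \<subseteq> set (walk_edges p)"
    using q(6) by (metis set_mset_mono set_mset_mset)
  with q assms have "q \<in> st_walks E s t" by (auto simp: st_walks_iff)
  with q that show ?thesis by blast
qed

lemma acyclic_imp_distinct_walk:
  assumes "acyclic E" "set (walk_edges p) \<subseteq> E"
  shows "distinct p"
proof (rule ccontr)
  assume "\<not> distinct p"
  then obtain xs y ys zs where p: "p = xs @ [y] @ ys @ [y] @ zs"
    using not_distinct_decomp by blast
  have *: "set (walk_edges (x # ws @ [z])) \<subseteq> E \<Longrightarrow> (x, z) \<in> E\<^sup>+" for x ws z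
    by (induction ws arbitrary: x) (auto intro: trancl_into_trancl2)
  have "set (walk_edges (y # ys @ [y])) \<subseteq> E"
    using assms(2) walk_edges_append[of xs y "ys @ [y] @ zs"]
      walk_edges_append[of "y # ys" y zs] by (simp add: p)
  from *[OF this] assms(1) show False by (auto simp: acyclic_def)
qed

text \<open>Potential differences telescope along a walk. A potential thus certifies a lower bound
  for all walks at once; with equality on every edge, as in the next lemma, it computes the cost
  exactly.\<close>

lemma sum_list_walk_ge_potential:
  fixes h :: "'v \<Rightarrow> real"
  assumes "p \<noteq> []" "\<And>u v. (u, v) \<in> set (walk_edges p) \<Longrightarrow> h v - h u \<le> c (u, v)"
  shows "h (last p) - h (hd p) \<le> sum_list (map c (walk_edges p))"
  using assms
proof (induction p rule: induct_list012)
  case (3 x y zs)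
  have "h (last (y # zs)) - h y \<le> sum_list (map c (walk_edges (y # zs)))"
    using 3 by auto
  moreover have "h y - h x \<le> c (x, y)" using 3(4) by simp
  ultimately show ?case by auto
qed auto

lemma sum_list_walk_eq_potential:
  fixes h :: "'v \<Rightarrow> real"
  assumes "p \<noteq> []" "\<And>u v. (u, v) \<in> set (walk_edges p) \<Longrightarrow> h v - h u = c (u, v)"
  shows "sum_list (map c (walk_edges p)) = h (last p) - h (hd p)"
  using assms
proof (induction p rule: induct_list012)
  case (3 x y zs)
  have "h (last (y # zs)) - h y = sum_list (map c (walk_edges (y # zs)))"
    using 3 by auto
  moreover have "h y - h x = c (x, y)" using 3(4) by simp
  ultimately show ?case by auto
qed auto

lemma sum_list_count_list:
  fixes c :: "'a \<Rightarrow> 'b::comm_semiring_1"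
  assumes "finite A" "set xs \<subseteq> A"
  shows "sum_list (map c xs) = (\<Sum>x\<in>A. of_nat (count_list xs x) * c x)"
  using assms(2)
proof (induction xs)
  case (Cons y xs)
  have "(\<Sum>x\<in>A. of_nat (count_list (y # xs) x) * c x) =
    (\<Sum>x\<in>A. of_nat (count_list xs x) * c x + (if y = x then c x else 0))"
    by (rule sum.cong) (auto simp: algebra_simps)
  also have "\<dots> = sum_list (map c xs) + c y"
    using Cons assms(1) by (simp add: sum.distrib)
  finally show ?case by (simp add: add.commute)
qed simp

lemma count_list_distinct: "distinct xs \<Longrightarrow> count_list xs x = (if x \<in> set xs then 1 else 0)"
  by (induction xs) auto

lemma sum_count_list_distinct:
  "distinct xs \<Longrightarrow> finite A \<Longrightarrow> (\<Sum>x\<in>A. count_list xs x) = card (A \<inter> set xs)"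
  by (simp add: count_list_distinct sum.If_cases)

lemma st_graph_finite_edges: "st_graph V E s t \<Longrightarrow> finite E"
  unfolding st_graph_def by (meson finite_SigmaI finite_subset)

lemma st_graph_obtain_walk:
  assumes "st_graph V E s t"
  obtains p where "p \<in> st_walks E s t" "distinct p"
  using assms st_walk_loop_erasure unfolding st_graph_def by metis

lemma st_walk_vertices:
  assumes "st_graph V E s t" "p \<in> st_walks E s t"
  shows "set p \<subseteq> V"
proof
  fix v assume "v \<in> set p"
  then obtain xs ys where p: "p = xs @ v # ys" by (meson split_list)
  show "v \<in> V"
  proof (cases ys)
    case Nil
    then show ?thesis using assms p by (auto simp: st_walks_iff st_graph_def)
  next
    case (Cons w zs)
    then have "(v, w) \<in> set (walk_edges p)" using p by (auto simp: in_walk_edges_iff)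
    then show ?thesis using assms by (auto simp: st_walks_iff st_graph_def)
  qed
qed

text \<open>The demand that every vertex lie on an s-t walk holds by construction in a union of s-t
  walks, so every subgraph needed later is built this way.\<close>

lemma st_subgraph_Union_walks:
  assumes G: "st_graph V E s t" and "Ps \<subseteq> st_walks E s t" "Ps \<noteq> {}"
  shows "st_subgraph V E (\<Union>p\<in>Ps. set p) (\<Union>p\<in>Ps. set (walk_edges p)) s t"
proof -
  have *: "set p \<subseteq> V" "set (walk_edges p) \<subseteq> E" "p \<noteq> []" "hd p = s" "last p = t"
    if "p \<in> Ps" for p
    using subsetD[OF assms(2) that] st_walk_vertices[OF G, of p] by (simp_all add: st_walks_iff)
  have V: "(\<Union>p\<in>Ps. set p) \<subseteq> V" and E: "(\<Union>p\<in>Ps. set (walk_edges p)) \<subseteq> E"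
    using * by blast+
  obtain p0 where p0: "p0 \<in> Ps" using assms(3) by blast
  have "s \<in> set p0" "t \<in> set p0" using *[OF p0] by (metis hd_in_set, metis last_in_set)
  then have st: "s \<in> (\<Union>p\<in>Ps. set p)" "t \<in> (\<Union>p\<in>Ps. set p)" using p0 by auto
  have "p \<in> st_walks (\<Union>p\<in>Ps. set (walk_edges p)) s t" if "p \<in> Ps" for p
    using *[OF that] that by (auto simp: st_walks_iff)
  then have "\<forall>v\<in>(\<Union>p\<in>Ps. set p). \<exists>p\<in>st_walks (\<Union>p\<in>Ps. set (walk_edges p)) s t. v \<in> set p"
    by blast
  moreover have "(\<Union>p\<in>Ps. set (walk_edges p)) \<subseteq> (\<Union>p\<in>Ps. set p) \<times> (\<Union>p\<in>Ps. set p)"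
    using walk_edges_subset by fast
  moreover have "finite (\<Union>p\<in>Ps. set p)"
    using V G finite_subset by (auto simp: st_graph_def)
  ultimately show ?thesis
    using V E st G unfolding st_subgraph_def st_graph_def by blast
qed

lemma walk_edges_append_nonempty:
  "xs \<noteq> [] \<Longrightarrow> ys \<noteq> [] \<Longrightarrow>
   walk_edges (xs @ ys) = walk_edges xs @ (last xs, hd ys) # walk_edges ys"
  by (induction xs rule: induct_list012) (auto simp: neq_Nil_conv)

lemma walk_edges_append3:
  "xs \<noteq> [] \<Longrightarrow> ys \<noteq> [] \<Longrightarrow> zs \<noteq> [] \<Longrightarrow> walk_edges (xs @ ys @ zs) =
   walk_edges xs @ (last xs, hd ys) # walk_edges ys @ (last ys, hd zs) # walk_edges zs"
  by (simp add: walk_edges_append_nonempty)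

text \<open>A numbering that increases along all the walks is a topological order of their
  union.\<close>

lemma acyclic_if_sorted:
  fixes f :: "'a \<Rightarrow> nat"
  assumes "\<And>p. p \<in> Ps \<Longrightarrow> sorted_wrt (\<lambda>u v. f u < f v) p"
  shows "acyclic (\<Union>p\<in>Ps. set (walk_edges p))"
proof -
  have "set (walk_edges p) \<subseteq> Wellfounded.measure f" if "p \<in> Ps" for p
    using successively_if_sorted_wrt[OF assms[OF that]]
    by (simp add: successively_iff_walk_edges[symmetric])
  then have "(\<Union>p\<in>Ps. set (walk_edges p)) \<subseteq> Wellfounded.measure f" by blast
  then show ?thesis using acyclic_subset wf_acyclic wf_measure by blast
qed

lemma distinct_imp_sorted_index:
  assumes "distinct L"
  obtains f :: "'a \<Rightarrow> nat" where "sorted_wrt (\<lambda>u v. f u < f v) L"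
proof -
  define f where "f v = (SOME i. i < length L \<and> L ! i = v)" for v
  have "f (L ! i) = i" if "i < length L" for i
    unfolding f_def using that assms by (intro some_equality) (auto simp: nth_eq_iff_index_eq)
  then have "sorted_wrt (\<lambda>u v. f u < f v) L"
    unfolding sorted_wrt_iff_nth_less by simp
  with that show ?thesis by blast
qed

section \<open>Wheatstone networks from crossing walks\<close>

text \<open>A subdivided Wheatstone network with tails: the path runs through x, a, b, y in this
  order, c is the interior of a bypass from x to b, and d that of a bypass from a to y.
  The list whose distinctness is required is in topological order.\<close>

definition wheatstone where
  "wheatstone E s t U1 x U2 a Q b W1 y W2 c d \<longleftrightarrow>
     distinct (U1 @ x # c @ U2 @ a # d @ Q @ b # W1 @ y # W2) \<and>
     U1 @ x # U2 @ a # Q @ b # W1 @ y # W2 \<in> st_walks E s t \<and>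
     set (walk_edges (x # c @ [b])) \<subseteq> E \<and> set (walk_edges (a # d @ [y])) \<subseteq> E"

definition has_wheatstone where
  "has_wheatstone E s t \<longleftrightarrow>
     (\<exists>U1 x U2 a Q b W1 y W2 c d. wheatstone E s t U1 x U2 a Q b W1 y W2 c d)"

lemma has_wheatstone_mono: "E \<subseteq> E' \<Longrightarrow> has_wheatstone E s t \<Longrightarrow> has_wheatstone E' s t"
proof -
  assume "E \<subseteq> E'" "has_wheatstone E s t"
  then obtain U1 x U2 a Q b W1 y W2 c d where "wheatstone E s t U1 x U2 a Q b W1 y W2 c d"
    unfolding has_wheatstone_def by blast
  then have "wheatstone E' s t U1 x U2 a Q b W1 y W2 c d"
    using \<open>E \<subseteq> E'\<close> st_walks_mono[OF \<open>E \<subseteq> E'\<close>, of s t] unfolding wheatstone_def by blast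
  then show ?thesis unfolding has_wheatstone_def by blast
qed

text \<open>An excursion of \<open>w\<close> off \<open>p\<close>: it leaves at position
  \<open>i\<close>, returns at position \<open>j\<close>, and has interior \<open>c\<close> off
  \<open>p\<close>. Its edges come from \<open>w\<close>, but it need not be a contiguous piece of
  \<open>w\<close>, since loops may have been erased. Positions instead of vertices allow jumps to
  be compared by length.\<close>

definition jump where
  "jump p w i j c \<longleftrightarrow> p ! i \<in> set w \<and> p ! j \<in> set w \<and> set c \<subseteq> set w - set p \<and> distinct c \<and>
     set (walk_edges (p ! i # c @ [p ! j])) \<subseteq> set (walk_edges w)"

text \<open>Take the last vertex of \<open>w\<close> lying on \<open>p\<close> before position
  \<open>m\<close>, and then the next vertex of \<open>w\<close> on \<open>p\<close>. By the choice
  of the first it is not before \<open>m\<close>, and it is not at \<open>m\<close> because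
  \<open>w\<close> misses that vertex; so it lies beyond.\<close>

lemma obtain_jump_across:
  assumes p: "distinct p" and w: "w \<noteq> []" "hd w = p ! i0" "last w = p ! i1"
    and ord: "i0 < m" "m < i1" "i1 < length p" and m: "p ! m \<notin> set w"
  obtains i j c where "i < m" "m < j" "j < length p" "jump p w i j c"
proof -
  define L where "L v \<longleftrightarrow> (\<exists>i<m. v = p ! i)" for v
  have "\<exists>x\<in>set w. L x"
    using w ord by (metis L_def hd_in_set)
  then obtain w1 u w2 where w12: "w = w1 @ u # w2" "L u" "\<forall>z\<in>set w2. \<not> L z"
    by (rule split_list_last_propE)
  have not_L: "\<not> L (p ! i1)"
    using p ord unfolding L_def by (metis less_trans nat_neq_iff nth_eq_iff_index_eq)
  then have "w2 \<noteq> []" using w12 w by auto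
  then have "\<exists>x\<in>set w2. x \<in> set p"
    using w12 w ord by (metis last.simps last_append last_in_set list.distinct(1) nth_mem)
  then obtain c v w3 where w23: "w2 = c @ v # w3" "v \<in> set p" "\<forall>y\<in>set c. y \<notin> set p"
    by (rule split_list_first_propE)
  obtain i where i: "i < m" "u = p ! i" using w12 L_def by blast
  obtain j where j: "j < length p" "v = p ! j" using w23 by (metis in_set_conv_nth)
  have "\<not> L v" using w12 w23 by simp
  then have "m < j" using j m w12 w23 unfolding L_def
    by (metis in_set_conv_decomp linorder_neqE_nat set_append Un_iff list.set_intros(2))
  \<comment> \<open>\<open>w\<close> may repeat vertices, so the excursion is made simple; its ends
    survive because they differ.\<close>
  obtain q where q: "distinct q" "q \<noteq> []" "hd q = u" "last q = v"
    "set q \<subseteq> set (u # c @ [v])" "mset (walk_edges q) \<subseteq># mset (walk_edges (u # c @ [v]))"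
    using loop_erasure[of "u # c @ [v]"] by auto
  have "u \<noteq> v" using w12 \<open>\<not> L v\<close> by blast
  obtain q1 where q1: "q = u # q1" using q by (cases q) auto
  then have "q1 \<noteq> []" "last q1 = v" using q \<open>u \<noteq> v\<close> by auto
  then obtain c' where c': "q = u # c' @ [v]" using q1 by (metis append_butlast_last_id)
  then have "set c' \<subseteq> set c" using q by auto
  have "w = w1 @ u # c @ v # w3" using w12 w23 by simp
  then have we: "set (walk_edges (u # c @ [v])) \<subseteq> set (walk_edges w)"
    using walk_edges_append[of w1 u "c @ v # w3"] walk_edges_append[of "u # c" v w3] by auto
  have "set (walk_edges q) \<subseteq> set (walk_edges w)"
    using we q(6) by (metis order_trans set_mset_mono set_mset_mset)
  then have "jump p w i j c'"
    unfolding jump_def using i j c' q(1) \<open>set c' \<subseteq> set c\<close> w12 w23 by auto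
  with i j \<open>m < j\<close> that show ?thesis by blast
qed

lemma obtain_nested_decomp:
  assumes "i < k" "k < j" "j < l" "l < length p"
  obtains U1 U2 Q W1 W2 where
    "p = U1 @ p ! i # U2 @ p ! k # Q @ p ! j # W1 @ p ! l # W2"
proof -
  have *: "drop m p = take (n - m) (drop m p) @ p ! n # drop (Suc n) p"
    if "m \<le> n" "n < length p" for m n
  proof -
    have "n - m < length (drop m p)" using that by simp
    from id_take_nth_drop[OF this] show ?thesis using that by simp
  qed
  have "p = take i p @ p ! i # drop (Suc i) p"
    using id_take_nth_drop assms by (metis less_trans)
  also have "drop (Suc i) p = take (k - Suc i) (drop (Suc i) p) @ p ! k # drop (Suc k) p"
    using assms by (intro *) auto
  also have "drop (Suc k) p = take (j - Suc k) (drop (Suc k) p) @ p ! j # drop (Suc j) p"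
    using assms by (intro *) auto
  also have "drop (Suc j) p = take (l - Suc j) (drop (Suc j) p) @ p ! l # drop (Suc l) p"
    using assms by (intro *) auto
  finally show ?thesis by (rule that)
qed

text \<open>Positions refer to p. Among the jumps of B over the position m take a longest one, i to j.
  The walk A passes j by some jump from k to l. If k lies between i and j, the two jumps overlap
  and give a Wheatstone network. Otherwise k < i, and B passes k by a jump which ends before l,
  so that it overlaps the jump of A, or contradicts the maximality.\<close>

lemma crossing_imp_wheatstone:
  assumes p: "p \<in> st_walks E s t" "distinct p" and mn: "m < n" "n < length p"
    and A: "A \<noteq> []" "hd A = p ! m" "last A = t" "set (walk_edges A) \<subseteq> E"
    and B: "B \<noteq> []" "hd B = s" "last B = p ! n" "set (walk_edges B) \<subseteq> E"
    and disj: "set A \<inter> set B = {}"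
  shows "has_wheatstone E s t"
proof -
  have s: "p ! 0 = s" and t: "p ! (length p - 1) = t" and "p \<noteq> []"
    using p by (auto simp: st_walks_iff hd_conv_nth last_conv_nth)
  have sB: "s \<in> set B" and tA: "t \<in> set A" and mA: "p ! m \<in> set A" and nB: "p ! n \<in> set B"
    using A B by (metis hd_in_set last_in_set)+
  then have "m \<noteq> 0" "n \<noteq> length p - 1"
    using disj s t by auto
  then have ends: "0 < m" "n < length p - 1" using mn by auto
  \<comment> \<open>The interleaving i < k < j < l is the Wheatstone pattern, with branch vertices
    x, a, b, y at these positions. The two bypasses avoid p as jumps do, and avoid each other
    because A and B are disjoint.\<close>
  have overlap: ?thesis
    if jmp: "i < k" "k < j" "j < l" "l < length p" "jump p B i j c" "jump p A k l d" for i j k l c d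
  proof -
    obtain U1 U2 Q W1 W2 where d: "p = U1 @ p ! i # U2 @ p ! k # Q @ p ! j # W1 @ p ! l # W2"
      using obtain_nested_decomp[OF jmp(1-4)] .
    define x a b y where "x = p ! i" "a = p ! k" "b = p ! j" "y = p ! l"
    note d' = d[folded x_a_b_y_def]
    have jumps: "set c \<inter> set p = {}" "set d \<inter> set p = {}" "set c \<inter> set d = {}"
      "distinct c" "distinct d"
      "set (walk_edges (x # c @ [b])) \<subseteq> E" "set (walk_edges (a # d @ [y])) \<subseteq> E"
      using jmp(5,6) disj A B unfolding jump_def x_a_b_y_def by blast+
    have "distinct (U1 @ x # c @ U2 @ a # d @ Q @ b # W1 @ y # W2)"
    proof -
      have "distinct (p @ c @ d)" using jumps(1-5) p(2) by auto
      moreover have "mset (U1 @ x # c @ U2 @ a # d @ Q @ b # W1 @ y # W2) = mset (p @ c @ d)"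
        by (subst d') simp
      ultimately show ?thesis using mset_eq_imp_distinct_iff by blast
    qed
    moreover have "U1 @ x # U2 @ a # Q @ b # W1 @ y # W2 \<in> st_walks E s t"
      using p(1) d' by simp
    ultimately have "wheatstone E s t U1 x U2 a Q b W1 y W2 c d"
      unfolding wheatstone_def using jumps by simp
    then show ?thesis unfolding has_wheatstone_def by blast
  qed
  define J where "J = (\<lambda>(i, j). i < m \<and> m < j \<and> j < length p \<and> (\<exists>c. jump p B i j c))"
  have "p ! m \<notin> set B" using mA disj by blast
  then obtain i0 j0 c0 where "i0 < m" "m < j0" "j0 < length p" "jump p B i0 j0 c0"
    using obtain_jump_across[OF p(2) B(1), of 0 n m] B s ends mn by auto
  then have J0: "J (i0, j0)" unfolding J_def by auto
  have "\<forall>ij. J ij \<longrightarrow> (\<lambda>(i, j). j - i) ij < Suc (length p)" unfolding J_def by auto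
  from ex_has_greatest_nat[of J, OF J0 this] obtain i j where "J (i, j)"
    and max: "\<And>i' j'. J (i', j') \<Longrightarrow> j' - i' \<le> j - i"
    by auto
  then obtain c where ij: "i < m" "m < j" "j < length p" "jump p B i j c"
    unfolding J_def by auto
  \<comment> \<open>Both ends of the jump lie on B and hence off A. As A ends in t, position j is
    not the last one, and A has to jump over it.\<close>
  have "p ! j \<notin> set A" "p ! i \<notin> set A" using ij(4) disj unfolding jump_def by auto
  have "j < length p - 1"
  proof -
    have "j \<noteq> length p - 1" using \<open>p ! j \<notin> set A\<close> tA t by auto
    then show ?thesis using ij(3) by simp
  qed
  moreover have "length p - 1 < length p" using mn by simp
  ultimately obtain k l d where kl: "k < j" "j < l" "l < length p" "jump p A k l d"
    using obtain_jump_across[OF p(2) A(1), of m "length p - 1" j] A t ij \<open>p ! j \<notin> set A\<close>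
    by metis
  have kA: "p ! k \<in> set A" "p ! l \<in> set A" using kl(4) unfolding jump_def by auto
  then have "k \<noteq> i" using \<open>p ! i \<notin> set A\<close> by auto
  show ?thesis
  proof (cases "i < k")
    case True
    then show ?thesis using overlap kl ij by blast
  next
    case False
    then have "k < i" using \<open>k \<noteq> i\<close> by simp
    have "p ! k \<notin> set B" "p ! l \<notin> set B" using kA disj by auto
    then have "k \<noteq> 0" using sB s by metis
    then obtain i' j' c' where ij': "i' < k" "k < j'" "j' < length p" "jump p B i' j' c'"
      using obtain_jump_across[OF p(2) B(1), of 0 n k] B s mn \<open>k < i\<close> ij \<open>p ! k \<notin> set B\<close> by auto
    have "j' \<noteq> l" using ij'(4) \<open>p ! l \<notin> set B\<close> unfolding jump_def by auto
    \<comment> \<open>Otherwise i' < i and j < j', so the new jump would also span m and be longer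
      than the longest.\<close>
    moreover have "\<not> l < j'"
    proof
      assume "l < j'"
      then have "J (i', j')" unfolding J_def using ij' kl ij \<open>k < i\<close> by auto
      with max[OF this] show False using ij ij' \<open>k < i\<close> kl \<open>l < j'\<close> by linarith
    qed
    ultimately have "j' < l" by simp
    then show ?thesis using overlap ij' kl by blast
  qed
qed

section \<open>Weakness\<close>

lemma minimal_hitting_set:
  assumes "finite K0" "\<And>w. w \<in> W \<Longrightarrow> items w \<inter> K0 \<noteq> {}"
  obtains K where "K \<subseteq> K0" "\<forall>w\<in>W. items w \<inter> K \<noteq> {}"
    "\<forall>k\<in>K. \<exists>w\<in>W. items w \<inter> K = {k}"
proof -
  let ?S = "{K. K \<subseteq> K0 \<and> (\<forall>w\<in>W. items w \<inter> K \<noteq> {})}"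
  have "finite ?S" using assms(1) by auto
  moreover have "K0 \<in> ?S" using assms(2) by auto
  ultimately obtain K where K: "K \<in> ?S" and min: "\<And>K'. K' \<in> ?S \<Longrightarrow> K' \<subseteq> K \<Longrightarrow> K = K'"
    using finite_has_minimal2[of ?S K0] by auto
  have "\<exists>w\<in>W. items w \<inter> K = {k}" if "k \<in> K" for k
  proof -
    have "K - {k} \<notin> ?S" using min[of "K - {k}"] that by auto
    then obtain w where "w \<in> W" "items w \<inter> (K - {k}) = {}" using K by auto
    moreover have "items w \<inter> K \<noteq> {}" using K \<open>w \<in> W\<close> by auto
    ultimately show ?thesis by (intro bexI[of _ w]) auto
  qed
  with K that show ?thesis by auto
qed

lemma vload_superset:
  "finite A \<Longrightarrow> supp \<phi> \<subseteq> A \<Longrightarrow> vload \<phi> v = (\<Sum>p\<in>A. count_list p v * \<phi> p)"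
  unfolding vload_def by (rule sum.mono_neutral_left) (auto simp: supp_def)

lemma nflow_value_superset:
  "finite A \<Longrightarrow> supp \<phi> \<subseteq> A \<Longrightarrow> nflow_value \<phi> = (\<Sum>p\<in>A. \<phi> p)"
  unfolding nflow_value_def by (rule sum.mono_neutral_left) (auto simp: supp_def)

lemma sum_vload:
  "(\<Sum>v\<in>K. vload \<phi> v) = (\<Sum>p\<in>supp \<phi>. (\<Sum>v\<in>K. count_list p v) * \<phi> p)"
  unfolding vload_def by (subst sum.swap) (simp add: sum_distrib_right)

lemma nflow_value_pos_imp: "0 < nflow_value \<phi> \<Longrightarrow> \<exists>p. p \<in> supp \<phi>"
  unfolding nflow_value_def by (metis less_numeral_extra(3) sum.neutral)

text \<open>Flows can be augmented inside the residual charges. This makes the values unbounded when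
  no flow inhibits.\<close>

lemma nflow_add_residual:
  assumes \<phi>: "nflow E s t \<eta> \<phi>" and \<psi>: "nflow E s t (residual \<eta> \<phi>) \<psi>"
  shows "nflow E s t \<eta> (\<lambda>p. \<phi> p + \<psi> p)"
    and "nflow_value (\<lambda>p. \<phi> p + \<psi> p) = nflow_value \<phi> + nflow_value \<psi>"
proof -
  let ?S = "supp \<phi> \<union> supp \<psi>"
  have fin: "finite ?S" and sub: "?S \<subseteq> st_walks E s t"
    using assms by (auto simp: nflow_def)
  have supp: "supp (\<lambda>p. \<phi> p + \<psi> p) = ?S" by (auto simp: supp_def)
  have load: "vload (\<lambda>p. \<phi> p + \<psi> p) v = vload \<phi> v + vload \<psi> v" for v
    using fin supp by (simp add: vload_superset[of ?S] algebra_simps sum.distrib)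
  have "enat (vload \<phi> v + vload \<psi> v) \<le> \<eta> v" for v
  proof -
    have "enat (vload \<phi> v) \<le> \<eta> v" "enat (vload \<psi> v) \<le> \<eta> v - enat (vload \<phi> v)"
      using assms by (auto simp: nflow_def residual_def)
    then show ?thesis by (cases "\<eta> v") auto
  qed
  then show "nflow E s t \<eta> (\<lambda>p. \<phi> p + \<psi> p)"
    using fin sub supp load by (simp add: nflow_def)
  show "nflow_value (\<lambda>p. \<phi> p + \<psi> p) = nflow_value \<phi> + nflow_value \<psi>"
    using fin supp by (simp add: nflow_value_superset[of ?S] sum.distrib)
qed

lemma nflow_single:
  assumes "p \<in> st_walks E s t" "\<And>v. enat (count_list p v) \<le> \<eta> v"
  shows "nflow E s t \<eta> ((\<lambda>_. 0)(p := 1))" "nflow_value ((\<lambda>_. 0)(p := 1)) = 1"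
    "vload ((\<lambda>_. 0)(p := 1)) v = count_list p v"
proof -
  have supp: "supp ((\<lambda>_. 0)(p := 1 :: nat)) = {p}" by (auto simp: supp_def)
  show "nflow_value ((\<lambda>_. 0)(p := 1)) = 1" unfolding nflow_value_def supp by simp
  have load: "vload ((\<lambda>_. 0)(p := 1)) v = count_list p v" for v
    unfolding vload_def supp by simp
  then show "vload ((\<lambda>_. 0)(p := 1)) v = count_list p v" .
  show "nflow E s t \<eta> ((\<lambda>_. 0)(p := 1))"
    using assms unfolding nflow_def supp load by simp
qed

text \<open>If no inhibiting flow is beaten by a flow, all inhibiting flows have the maximum value
  and the two extrema agree. The delicate case is that no inhibiting flow exists at all.\<close>

lemma weak_imp_smaller_inhibiting_flow:
  assumes "weak E s t"
  obtains \<eta> \<phi> \<psi> where "inhibits E s t \<eta> \<phi>" "nflow E s t \<eta> \<psi>"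
    "nflow_value \<phi> < nflow_value \<psi>"
proof -
  obtain \<eta> where \<eta>: "min_inhibiting E s t \<eta> \<noteq> max_flow E s t \<eta>"
    using assms by (auto simp: weak_def)
  have "\<exists>\<phi> \<psi>. inhibits E s t \<eta> \<phi> \<and> nflow E s t \<eta> \<psi> \<and> nflow_value \<phi> < nflow_value \<psi>"
  proof (rule ccontr)
    assume "\<not> ?thesis"
    then have le: "nflow_value \<psi> \<le> nflow_value \<phi>"
      if "inhibits E s t \<eta> \<phi>" "nflow E s t \<eta> \<psi>" for \<phi> \<psi>
      using that by (meson linorder_not_le)
    have eq: "enat (nflow_value \<phi>) = max_flow E s t \<eta>" if "inhibits E s t \<eta> \<phi>" for \<phi>
    proof (rule antisym)
      have "nflow E s t \<eta> \<phi>" using that by (simp add: inhibits_def)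
      then show "enat (nflow_value \<phi>) \<le> max_flow E s t \<eta>"
        unfolding max_flow_def by (intro Sup_upper) auto
      show "max_flow E s t \<eta> \<le> enat (nflow_value \<phi>)"
        unfolding max_flow_def by (rule Sup_least) (use le that in auto)
    qed
    show False
    proof (cases "\<exists>\<phi>. inhibits E s t \<eta> \<phi>")
      case True
      then obtain \<phi>0 where "inhibits E s t \<eta> \<phi>0" by blast
      then have "{enat (nflow_value \<phi>) | \<phi>. inhibits E s t \<eta> \<phi>} = {max_flow E s t \<eta>}"
        using eq by (auto intro!: exI[of _ \<phi>0])
      then show False using \<eta> by (simp add: min_inhibiting_def)
    next
      \<comment> \<open>The infimum of the empty set is \<infinity>. Every flow can then be
        augmented, so the supremum is \<infinity> as well.\<close>
      case False
      then have "min_inhibiting E s t \<eta> = \<infinity>"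
        by (simp add: min_inhibiting_def Inf_enat_def)
      moreover have "\<exists>\<phi>. nflow E s t \<eta> \<phi> \<and> n \<le> nflow_value \<phi>" for n
      proof (induction n)
        case 0
        have "nflow E s t \<eta> (\<lambda>_. 0)" by (simp add: nflow_def supp_def vload_def zero_enat_def[symmetric])
        then show ?case by auto
      next
        case (Suc n)
        then obtain \<phi> where \<phi>: "nflow E s t \<eta> \<phi>" "n \<le> nflow_value \<phi>" by blast
        then obtain \<psi> where "nflow E s t (residual \<eta> \<phi>) \<psi>" "0 < nflow_value \<psi>"
          using False by (auto simp: inhibits_def)
        then show ?case using nflow_add_residual[OF \<phi>(1)] \<phi>(2)
          by (intro exI[of _ "\<lambda>p. \<phi> p + \<psi> p"]) auto
      qed
      then have "enat n \<le> max_flow E s t \<eta>" for n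
        unfolding max_flow_def by (metis (mono_tags, lifting) Sup_upper2 enat_ord_simps(1) mem_Collect_eq)
      then have "max_flow E s t \<eta> = \<infinity>"
        by (metis Suc_ile_eq enat.exhaust not_enat_eq less_irrefl)
      ultimately show False using \<eta> by simp
    qed
  qed
  with that show ?thesis by blast
qed

lemma obtain_two_positions:
  assumes "2 \<le> card (K \<inter> set p)"
  obtains m n where "m < n" "n < length p" "p ! m \<in> K" "p ! n \<in> K"
proof -
  obtain T where "T \<subseteq> K \<inter> set p" "card T = 2" "finite T"
    using obtain_subset_with_card_n[OF assms] .
  then obtain u v where uv: "u \<in> K \<inter> set p" "v \<in> K \<inter> set p" "u \<noteq> v"
    by (auto simp: card_2_iff)
  then obtain i j where ij: "i < length p" "j < length p" "p ! i = u" "p ! j = v"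
    by (auto simp: in_set_conv_nth)
  have "i < j \<or> j < i" using ij uv by (cases i j rule: linorder_cases) auto
  then show ?thesis using that[of i j] that[of j i] ij uv by auto
qed

text \<open>Acyclicity makes all walks simple. A walk without saturated vertices thus needs only one
  unit of charge at each of its vertices and could be added to the inhibiting flow; hence the
  saturated vertices form a cut.\<close>

lemma weak_acyclic_imp_wheatstone:
  assumes G: "st_graph V E s t" and "acyclic E" "weak E s t"
  shows "has_wheatstone E s t"
proof -
  obtain \<eta> \<phi> \<psi> where flows: "inhibits E s t \<eta> \<phi>" "nflow E s t \<eta> \<psi>"
    "nflow_value \<phi> < nflow_value \<psi>"
    using weak_imp_smaller_inhibiting_flow[OF assms(3)] by blast
  have dist: "distinct w" if "w \<in> st_walks E s t" for w
    using that acyclic_imp_distinct_walk[OF assms(2)] by (simp add: st_walks_iff)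
  let ?Sat = "{v \<in> V. residual \<eta> \<phi> v = 0}"
  have hitSat: "set w \<inter> ?Sat \<noteq> {}" if w: "w \<in> st_walks E s t" for w
  proof
    assume "set w \<inter> ?Sat = {}"
    then have "residual \<eta> \<phi> v \<noteq> 0" if "v \<in> set w" for v
      using st_walk_vertices[OF G w] that by auto
    then have "enat (count_list w v) \<le> residual \<eta> \<phi> v" for v
      using count_list_distinct[OF dist[OF w], of v]
      by (auto simp: Suc_ile_eq zero_enat_def[symmetric])
    from nflow_single[OF w this] show False
      using flows(1) unfolding inhibits_def by (metis less_numeral_extra(1))
  qed
  have finSat: "finite ?Sat" using G by (simp add: st_graph_def)
  obtain K where K: "K \<subseteq> ?Sat"
    and hit: "\<forall>w\<in>st_walks E s t. set w \<inter> K \<noteq> {}"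
    and min: "\<forall>k\<in>K. \<exists>w\<in>st_walks E s t. set w \<inter> K = {k}"
    using minimal_hitting_set[of ?Sat "st_walks E s t" set, OF finSat hitSat] by blast
  have finK: "finite K" using K G by (auto simp: st_graph_def intro: finite_subset)
  \<comment> \<open>A zero residual forces a finite charge, used up entirely by \<phi>; the load of
    \<psi> cannot exceed it.\<close>
  have "vload \<psi> v \<le> vload \<phi> v" if "v \<in> K" for v
  proof -
    have "\<eta> v - enat (vload \<phi> v) = 0" "enat (vload \<psi> v) \<le> \<eta> v"
      using K that flows(2) by (auto simp: residual_def nflow_def)
    then show ?thesis by (cases "\<eta> v") (auto simp: zero_enat_def)
  qed
  then have KK: "(\<Sum>v\<in>K. vload \<psi> v) \<le> (\<Sum>v\<in>K. vload \<phi> v)" by (rule sum_mono)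
  \<comment> \<open>Double counting of the load on K: every walk of \<psi> meets K at least once, so
    if walks of \<phi> met it at most once, \<psi> could not have the larger value.\<close>
  have "\<exists>p\<in>supp \<phi>. 2 \<le> card (K \<inter> set p)"
  proof (rule ccontr)
    assume none: "\<not> ?thesis"
    have walks: "supp \<phi> \<subseteq> st_walks E s t" "supp \<psi> \<subseteq> st_walks E s t"
      using flows by (auto simp: inhibits_def nflow_def)
    have cnt: "(\<Sum>v\<in>K. count_list p v) = card (K \<inter> set p)" if "p \<in> supp \<phi> \<union> supp \<psi>" for p
      using that walks dist finK by (intro sum_count_list_distinct) auto
    have "nflow_value \<psi> \<le> (\<Sum>p\<in>supp \<psi>. (\<Sum>v\<in>K. count_list p v) * \<psi> p)"
      unfolding nflow_value_def
    proof (rule sum_mono)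
      fix p assume p: "p \<in> supp \<psi>"
      then have "K \<inter> set p \<noteq> {}" using hit walks by blast
      then have "1 \<le> card (K \<inter> set p)" using finK by (simp add: Suc_le_eq card_gt_0_iff)
      then show "\<psi> p \<le> (\<Sum>v\<in>K. count_list p v) * \<psi> p" using cnt p by simp
    qed
    also have "\<dots> = (\<Sum>v\<in>K. vload \<psi> v)" by (rule sum_vload[symmetric])
    also note KK
    also have "(\<Sum>v\<in>K. vload \<phi> v) = (\<Sum>p\<in>supp \<phi>. (\<Sum>v\<in>K. count_list p v) * \<phi> p)"
      by (rule sum_vload)
    also have "\<dots> \<le> nflow_value \<phi>"
      unfolding nflow_value_def
    proof (rule sum_mono)
      fix p assume p: "p \<in> supp \<phi>"
      then have "card (K \<inter> set p) \<le> 1" using none by force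
      then show "(\<Sum>v\<in>K. count_list p v) * \<phi> p \<le> \<phi> p" using cnt p by simp
    qed
    finally show False using flows(3) by simp
  qed
  then obtain p where p: "p \<in> supp \<phi>" "2 \<le> card (K \<inter> set p)" by blast
  then have pw: "p \<in> st_walks E s t" using flows(1) by (auto simp: inhibits_def nflow_def)
  obtain m n where mn: "m < n" "n < length p" "p ! m \<in> K" "p ! n \<in> K"
    using obtain_two_positions[OF p(2)] .
  then have neq: "p ! m \<noteq> p ! n" using dist[OF pw] by (simp add: nth_eq_iff_index_eq)
  obtain A where A: "A \<in> st_walks E s t" "set A \<inter> K = {p ! m}"
    using bspec[OF min mn(3)] by (elim bexE)
  obtain B where B: "B \<in> st_walks E s t" "set B \<inter> K = {p ! n}"
    using bspec[OF min mn(4)] by (elim bexE)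
  have nA: "p ! n \<notin> set A" and mB: "p ! m \<notin> set B"
    using A(2) B(2) mn(3,4) neq by (metis IntI singletonD)+
  have "p ! m \<in> set A" "p ! n \<in> set B" using A(2) B(2) by auto
  then obtain A1 A2 B1 B2 where A12: "A = A1 @ p ! m # A2" and B12: "B = B1 @ p ! n # B2"
    by (metis split_list)
  have eA: "set (walk_edges (p ! m # A2)) \<subseteq> E" "last (p ! m # A2) = t"
    using A(1) walk_edges_append[of A1 "p ! m" A2] by (auto simp: A12 st_walks_iff)
  have eB: "set (walk_edges (B1 @ [p ! n])) \<subseteq> E" "hd (B1 @ [p ! n]) = s"
    using B(1) walk_edges_append[of B1 "p ! n" B2]
    by (auto simp: B12 st_walks_iff hd_append)
  have dA: "distinct A" and dB: "distinct B" using dist A B by auto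
  \<comment> \<open>At a common vertex the start of B could be continued by the end of A. Since A
    and B are simple, the splice stops short of p ! n on B and begins after p ! m on A, so it would
    miss K.\<close>
  have "set (p ! m # A2) \<inter> set (B1 @ [p ! n]) = {}"
  proof (rule ccontr)
    assume "\<not> ?thesis"
    then obtain v where v: "v \<in> set (p ! m # A2)" "v \<in> set (B1 @ [p ! n])" by blast
    have "v \<noteq> p ! m" using v(2) mB B12 by auto
    have "v \<noteq> p ! n" using v(1) nA A12 by auto
    then obtain B3 B4 where B34: "B1 = B3 @ v # B4" using v(2) by (auto dest: split_list)
    obtain A3 A4 where A34: "A2 = A3 @ v # A4"
      using v(1) \<open>v \<noteq> p ! m\<close> by (auto dest: split_list)
    let ?w = "B3 @ v # A4"
    have "set (walk_edges ?w) \<subseteq> E"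
      using walk_splice_edges[of B3 v "B4 @ p ! n # B2" E "A1 @ p ! m # A3" A4] A(1) B(1)
      by (simp add: st_walks_iff A12 B12 A34 B34)
    moreover have "hd ?w = s" "last ?w = t"
      using A(1) B(1) by (auto simp: st_walks_iff A12 B12 A34 B34 hd_append)
    ultimately have "?w \<in> st_walks E s t" by (simp add: st_walks_iff)
    with hit have "set ?w \<inter> K \<noteq> {}" by blast
    moreover have "set ?w \<inter> K \<subseteq> {p ! m, p ! n}"
      using A(2) B(2) by (auto simp: A12 B12 A34 B34)
    moreover have "p ! m \<notin> set ?w" "p ! n \<notin> set ?w"
      using dA dB nA mB by (auto simp: A12 B12 A34 B34)
    ultimately show False by blast
  qed
  then show ?thesis
    using crossing_imp_wheatstone[OF pw dist[OF pw] mn(1,2), of "p ! m # A2" "B1 @ [p ! n]"] eA eB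
    by simp
qed

section \<open>The three paths of a Wheatstone network and its weakness\<close>

locale wheatstone_network =
  fixes V :: "'v set" and E s t U1 x U2 a Q b W1 y W2 c d
  assumes G: "st_graph V E s t" and wheatstone: "wheatstone E s t U1 x U2 a Q b W1 y W2 c d"
begin

text \<open>\<open>pathM\<close> runs through both a and b. \<open>pathA\<close> leaves it at a by
  the bypass d and misses b; \<open>pathB\<close> reaches b by the bypass c and misses a.\<close>

definition pathM where "pathM = U1 @ x # U2 @ a # Q @ b # W1 @ y # W2"
definition pathA where "pathA = U1 @ x # U2 @ a # d @ y # W2"
definition pathB where "pathB = U1 @ x # c @ b # W1 @ y # W2"

text \<open>These three blocks will be the levels 0, 1, 2 of the equilibrium potential of
  \<open>pathM\<close>. The bypass c is counted with the start and d with the end, so each bypass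
  changes level on a single edge.\<close>

definition N0 where "N0 = set (U1 @ x # c @ U2)"
definition N1 where "N1 = set (a # Q @ [b])"
definition N2 where "N2 = set (d @ W1 @ y # W2)"

text \<open>The edge of \<open>pathM\<close> entering a and the one leaving b; these will be the two
  congestible edges in Braess's example. \<open>last\<close> and \<open>hd\<close> cover the cases
  of empty \<open>U2\<close> and \<open>W1\<close>.\<close>

definition edge_a where "edge_a = (last (U1 @ x # U2), a)"
definition edge_b where "edge_b = (b, hd (W1 @ y # W2))"

lemma distinct_all: "distinct (U1 @ x # c @ U2 @ a # d @ Q @ b # W1 @ y # W2)"
  using wheatstone by (simp only: wheatstone_def)

lemma distinct_blocks: "distinct ((U1 @ x # c @ U2) @ (a # Q @ [b]) @ (d @ W1 @ y # W2))"
  using distinct_all by (rule mset_eq_imp_distinct_iff[THEN iffD1, rotated]) simp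

lemma N_disjoint: "N0 \<inter> N1 = {}" "N0 \<inter> N2 = {}" "N1 \<inter> N2 = {}"
  using distinct_blocks unfolding N0_def N1_def N2_def distinct_append set_append by blast+

lemma a_neq_b: "a \<noteq> b"
  using distinct_blocks unfolding distinct_append by simp

lemma distinct_M: "distinct (pathM @ c @ d)"
  and distinct_A: "distinct (pathA @ c @ Q @ b # W1)"
  and distinct_B: "distinct (pathB @ U2 @ a # d @ Q)"
  unfolding pathM_def pathA_def pathB_def
  using distinct_all by (rule mset_eq_imp_distinct_iff[THEN iffD1, rotated], simp)+

lemma paths_distinct: "distinct pathM" "distinct pathA" "distinct pathB"
  using distinct_M distinct_A distinct_B by simp_all

lemma a_notin_B: "a \<notin> set pathB" and b_notin_A: "b \<notin> set pathA"
  using distinct_A distinct_B by auto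

lemma edge_a_in: "fst edge_a \<in> N0" "snd edge_a = a"
  using last_in_set[of "U1 @ x # U2"] unfolding edge_a_def N0_def by auto

lemma edge_b_in: "fst edge_b = b" "snd edge_b \<in> N2"
  using hd_in_set[of "W1 @ y # W2"] unfolding edge_b_def N2_def by auto

lemma ab_in: "a \<in> N1" "b \<in> N1"
  by (auto simp: N1_def)

lemma walk_edges_M: "walk_edges pathM = walk_edges (U1 @ x # U2) @ edge_a #
    walk_edges (a # Q @ [b]) @ edge_b # walk_edges (W1 @ y # W2)"
  using walk_edges_append3[of "U1 @ x # U2" "a # Q @ [b]" "W1 @ y # W2"]
  unfolding pathM_def edge_a_def edge_b_def by simp

lemma walk_edges_A: "walk_edges pathA = walk_edges (U1 @ x # U2) @ edge_a #
    (a, hd (d @ y # W2)) # walk_edges (d @ y # W2)"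
  using walk_edges_append3[of "U1 @ x # U2" "[a]" "d @ y # W2"]
  unfolding pathA_def edge_a_def by simp

lemma walk_edges_B: "walk_edges pathB = walk_edges (U1 @ x # c) @ (last (U1 @ x # c), b) #
    edge_b # walk_edges (W1 @ y # W2)"
  using walk_edges_append3[of "U1 @ x # c" "[b]" "W1 @ y # W2"]
  unfolding pathB_def edge_b_def by simp

lemma block_edges:
  "set (walk_edges (U1 @ x # U2)) \<subseteq> N0 \<times> N0" "set (walk_edges (U1 @ x # c)) \<subseteq> N0 \<times> N0"
  "set (walk_edges (a # Q @ [b])) \<subseteq> N1 \<times> N1"
  "set (walk_edges (W1 @ y # W2)) \<subseteq> N2 \<times> N2" "set (walk_edges (d @ y # W2)) \<subseteq> N2 \<times> N2"
  by (rule order_trans[OF walk_edges_subset], rule Sigma_mono; force simp: N0_def N1_def N2_def)+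

text \<open>Sorting edges by blocks suffices for the later computations, because on the vertices of
  the paths concerned the potentials depend only on the block and on being a or b.\<close>

lemma edges_M:
  assumes "e \<in> set (walk_edges pathM)"
  shows "e \<in> N0 \<times> N0 \<or> e = edge_a \<or> e \<in> N1 \<times> N1 \<or> e = edge_b \<or> e \<in> N2 \<times> N2"
  using assms block_edges unfolding walk_edges_M set_append list.set by blast

lemma edges_A:
  assumes "e \<in> set (walk_edges pathA)"
  shows "e \<in> N0 \<times> N0 \<or> e = edge_a \<or> e \<in> {a} \<times> N2 \<or> e \<in> N2 \<times> N2"
proof -
  have "hd (d @ y # W2) \<in> N2" using hd_in_set[of "d @ y # W2"] by (auto simp: N2_def)
  then show ?thesis using assms block_edges unfolding walk_edges_A set_append list.set by blast
qed

lemma edges_B: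
  assumes "e \<in> set (walk_edges pathB)"
  shows "e \<in> N0 \<times> N0 \<or> e \<in> N0 \<times> {b} \<or> e = edge_b \<or> e \<in> N2 \<times> N2"
proof -
  have "last (U1 @ x # c) \<in> N0" using last_in_set[of "U1 @ x # c"] by (auto simp: N0_def)
  then show ?thesis using assms block_edges unfolding walk_edges_B set_append list.set by blast
qed

lemma edge_a_in_A: "edge_a \<in> set (walk_edges pathA)"
  and edge_b_in_B: "edge_b \<in> set (walk_edges pathB)"
  and edge_a_in_M: "edge_a \<in> set (walk_edges pathM)"
  and edge_b_in_M: "edge_b \<in> set (walk_edges pathM)"
  unfolding walk_edges_M walk_edges_A walk_edges_B by simp_all

lemma paths_st_walks:
  "pathM \<in> st_walks E s t" "pathA \<in> st_walks E s t" "pathB \<in> st_walks E s t"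
proof -
  show M: "pathM \<in> st_walks E s t" using wheatstone by (simp add: wheatstone_def pathM_def)
  note app = walk_edges_append[of U1 x] walk_edges_append[of "x # U2" a] walk_edges_append[of "x # c" b]
    walk_edges_append[of "a # Q" b] walk_edges_append[of "a # d" y] walk_edges_append[of "b # W1" y]
  have M1: "walk_edges pathM = walk_edges (U1 @ [x]) @ walk_edges (x # U2 @ [a]) @
    walk_edges (a # Q @ [b]) @ walk_edges (b # W1 @ [y]) @ walk_edges (y # W2)"
    unfolding pathM_def using app(1)[of "U2 @ a # Q @ b # W1 @ y # W2"]
      app(2)[of "Q @ b # W1 @ y # W2"] app(4)[of "W1 @ y # W2"] app(6)[of W2] by simp
  have A1: "walk_edges pathA = walk_edges (U1 @ [x]) @ walk_edges (x # U2 @ [a]) @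
    walk_edges (a # d @ [y]) @ walk_edges (y # W2)"
    unfolding pathA_def using app(1)[of "U2 @ a # d @ y # W2"] app(2)[of "d @ y # W2"]
      app(5)[of W2] by simp
  have B1: "walk_edges pathB = walk_edges (U1 @ [x]) @ walk_edges (x # c @ [b]) @
    walk_edges (b # W1 @ [y]) @ walk_edges (y # W2)"
    unfolding pathB_def using app(1)[of "c @ b # W1 @ y # W2"] app(3)[of "W1 @ y # W2"]
      app(6)[of W2] by simp
  have cd: "set (walk_edges (x # c @ [b])) \<subseteq> E" "set (walk_edges (a # d @ [y])) \<subseteq> E"
    using wheatstone by (simp_all only: wheatstone_def)
  have ends: "hd (U1 @ [x]) = s" "last (y # W2) = t"
    using M by (auto simp: st_walks_iff pathM_def hd_append)
  have "set (walk_edges pathM) \<subseteq> E" using M by (simp add: st_walks_iff)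
  then have "set (walk_edges pathA) \<subseteq> E" "set (walk_edges pathB) \<subseteq> E"
    unfolding A1 B1 M1 using cd by simp_all
  then show "pathA \<in> st_walks E s t" "pathB \<in> st_walks E s t"
    using ends by (auto simp: st_walks_iff pathA_def pathB_def hd_append)
qed

lemma s_in_N0: "s \<in> N0" and t_in_N2: "t \<in> N2"
proof -
  have "s = hd (U1 @ [x])" "t = last (y # W2)"
    using paths_st_walks(1) by (auto simp: st_walks_iff pathM_def hd_append)
  then have "s \<in> set (U1 @ [x])" "t \<in> set (y # W2)"
    by (metis hd_in_set snoc_eq_iff_butlast, metis last_in_set list.distinct(1))
  then show "s \<in> N0" "t \<in> N2" unfolding N0_def N2_def by auto
qed

text \<open>Within the union of the three paths every edge leaving \<open>N0\<close> ends in a or b,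
  so these two vertices separate s from t.\<close>

lemma walk_stays_in_N0:
  assumes "set (walk_edges w) \<subseteq> (\<Union>p\<in>{pathM, pathA, pathB}. set (walk_edges p))"
    and "w \<noteq> []" "hd w \<in> N0" "a \<notin> set w" "b \<notin> set w"
  shows "last w \<in> N0"
  using assms
proof (induction w rule: induct_list012)
  case (3 u v zs)
  have "(u, v) \<in> (\<Union>p\<in>{pathM, pathA, pathB}. set (walk_edges p))" "u \<in> N0" "v \<noteq> a" "v \<noteq> b" "u \<noteq> b"
    using "3.prems" by auto
  moreover have "u \<notin> N1" "u \<notin> N2" "u \<noteq> a"
    using \<open>u \<in> N0\<close> N_disjoint ab_in by auto
  moreover have "(u, v) \<noteq> edge_a" "(u, v) \<noteq> edge_b"
    using edge_a_in(2) edge_b_in(1) \<open>v \<noteq> a\<close> \<open>u \<noteq> b\<close> by (metis snd_conv, metis fst_conv)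
  ultimately have "v \<in> N0"
    using edges_M[of "(u, v)"] edges_A[of "(u, v)"] edges_B[of "(u, v)"] by auto
  then show ?case using 3 by auto
qed auto

lemma sorted_wrt_paths:
  assumes "sorted_wrt R (U1 @ x # c @ U2 @ a # d @ Q @ b # W1 @ y # W2)"
  shows "sorted_wrt R pathM" "sorted_wrt R pathA" "sorted_wrt R pathB"
  using assms unfolding pathM_def pathA_def pathB_def by (simp_all add: sorted_wrt_append ball_Un)

text \<open>One unit along \<open>pathM\<close> exhausts both a and b and blocks everything, whereas
  \<open>pathA\<close> and \<open>pathB\<close> use one of them each and carry two units. In all of
  E some walk might avoid both vertices, hence the restriction to the three paths.\<close>

lemma acyclic_weak_subgraph:
  "\<exists>V' E'. st_subgraph V E V' E' s t \<and> acyclic E' \<and> weak E' s t"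
proof -
  define Ps where "Ps = {pathM, pathA, pathB}"
  define V' where "V' = (\<Union>p\<in>Ps. set p)"
  define E' where "E' = (\<Union>p\<in>Ps. set (walk_edges p))"
  have sub: "st_subgraph V E V' E' s t"
    unfolding V'_def E'_def
    by (rule st_subgraph_Union_walks[OF G]) (use paths_st_walks in \<open>auto simp: Ps_def\<close>)
  obtain f :: "'v \<Rightarrow> nat" where
    "sorted_wrt (\<lambda>u v. f u < f v) (U1 @ x # c @ U2 @ a # d @ Q @ b # W1 @ y # W2)"
    using distinct_imp_sorted_index[OF distinct_all] .
  then have "sorted_wrt (\<lambda>u v. f u < f v) p" if "p \<in> Ps" for p
    using that sorted_wrt_paths unfolding Ps_def by auto
  then have acyc: "acyclic E'" unfolding E'_def by (rule acyclic_if_sorted)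
  have walks: "p \<in> st_walks E' s t" if "p \<in> Ps" for p
    using that paths_st_walks unfolding E'_def Ps_def by (auto simp: st_walks_iff)
  define \<eta> :: "'v \<Rightarrow> enat" where "\<eta> v = (if v = a \<or> v = b then 1 else \<infinity>)" for v
  have chan: "channel s t \<eta>"
    using s_in_N0 t_in_N2 ab_in N_disjoint by (auto simp: channel_def \<eta>_def)
  have aM: "a \<in> set pathM" "b \<in> set pathM" by (auto simp: pathM_def)
  have cM: "enat (count_list pathM v) \<le> \<eta> v" for v
    using count_list_distinct[OF paths_distinct(1), of v] by (auto simp: \<eta>_def one_enat_def)
  note M = nflow_single[OF walks, of pathM \<eta>, OF _ cM]
  have "inhibits E' s t \<eta> ((\<lambda>_. 0)(pathM := 1))"
    unfolding inhibits_def
  proof (intro conjI notI)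
    show "nflow E' s t \<eta> ((\<lambda>_. 0)(pathM := 1))" using M(1) by (simp add: Ps_def)
    assume "\<exists>\<psi>. nflow E' s t (residual \<eta> ((\<lambda>_. 0)(pathM := 1))) \<psi> \<and> 0 < nflow_value \<psi>"
    then obtain \<psi> where \<psi>: "nflow E' s t (residual \<eta> ((\<lambda>_. 0)(pathM := 1))) \<psi>" "0 < nflow_value \<psi>"
      by blast
    obtain w where w: "w \<in> supp \<psi>" using nflow_value_pos_imp[OF \<psi>(2)] by blast
    have fin: "finite (supp \<psi>)" and w': "w \<in> st_walks E' s t" using \<psi>(1) w by (auto simp: nflow_def)
    have "v \<notin> set w" if "v = a \<or> v = b" for v
    proof -
      have "vload ((\<lambda>_. 0)(pathM := 1)) v = 1"
        using M(3)[of v] that aM count_list_distinct[OF paths_distinct(1), of v] by (auto simp: Ps_def)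
      then have "residual \<eta> ((\<lambda>_. 0)(pathM := 1)) v = 0"
        using that by (simp add: residual_def \<eta>_def one_enat_def zero_enat_def)
      then have "vload \<psi> v = 0" using \<psi>(1) unfolding nflow_def
        by (metis enat_0_iff(1) ile0_eq)
      then have "count_list w v * \<psi> w = 0" using fin w unfolding vload_def by simp
      then show ?thesis using w by (auto simp: supp_def count_list_0_iff)
    qed
    then have "t \<in> N0"
      using walk_stays_in_N0[of w] w' s_in_N0 by (auto simp: st_walks_iff E'_def Ps_def)
    then show False using t_in_N2 N_disjoint by blast
  qed
  then have min: "min_inhibiting E' s t \<eta> \<le> 1"
    unfolding min_inhibiting_def using M(2)
    by (intro Inf_lower) (auto simp: Ps_def one_enat_def intro!: exI[of _ "(\<lambda>_. 0)(pathM := 1)"])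
  define \<psi> :: "'v list \<Rightarrow> nat" where "\<psi> = (\<lambda>_. 0)(pathA := 1, pathB := 1)"
  have AB: "a \<notin> set pathB" "b \<notin> set pathA" "a \<in> set pathA"
    using a_notin_B b_notin_A by (auto simp: pathA_def)
  then have neq: "pathA \<noteq> pathB" by auto
  have supp: "supp \<psi> = {pathA, pathB}" by (auto simp: \<psi>_def supp_def)
  have vl: "vload \<psi> v = count_list pathA v + count_list pathB v" for v
    unfolding vload_def supp using neq by (simp add: \<psi>_def)
  have "enat (vload \<psi> v) \<le> \<eta> v" for v
    unfolding vl using AB count_list_distinct[OF paths_distinct(2), of v]
      count_list_distinct[OF paths_distinct(3), of v] by (auto simp: \<eta>_def one_enat_def)
  then have "nflow E' s t \<eta> \<psi>"
    using walks by (simp add: nflow_def supp Ps_def)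
  moreover have "nflow_value \<psi> = 2"
    unfolding nflow_value_def supp using neq by (simp add: \<psi>_def)
  ultimately have "enat 2 \<le> max_flow E' s t \<eta>"
    unfolding max_flow_def by (intro Sup_upper) (auto intro!: exI[of _ \<psi>])
  moreover have "(1::enat) < enat 2" by (simp add: one_enat_def)
  ultimately have "min_inhibiting E' s t \<eta> \<noteq> max_flow E' s t \<eta>" using min by auto
  then have "weak E' s t" unfolding weak_def using chan by blast
  with sub acyc show ?thesis by blast
qed

end

lemma wheatstone_imp_acyclic_weak_subgraph:
  assumes "st_graph V E s t" "has_wheatstone E s t"
  shows "\<exists>V' E'. st_subgraph V E V' E' s t \<and> acyclic E' \<and> weak E' s t"
proof -
  obtain U1 x U2 a Q b W1 y W2 c d where "wheatstone E s t U1 x U2 a Q b W1 y W2 c d"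
    using assms(2) unfolding has_wheatstone_def by blast
  then interpret wheatstone_network V E s t U1 x U2 a Q b W1 y W2 c d
    using assms(1) by unfold_locales
  show ?thesis by (rule acyclic_weak_subgraph)
qed

section \<open>Wardrop flows\<close>

lemma edge_flow_superset:
  "finite A \<Longrightarrow> supp \<phi> \<subseteq> A \<Longrightarrow>
   edge_flow \<phi> e = (\<Sum>p\<in>A. real (count_list (walk_edges p) e) * \<phi> p)"
  unfolding edge_flow_def by (rule sum.mono_neutral_left) (auto simp: supp_def)

lemma rflow_value_superset:
  "finite A \<Longrightarrow> supp \<phi> \<subseteq> A \<Longrightarrow> rflow_value \<phi> = (\<Sum>p\<in>A. \<phi> p)"
  unfolding rflow_value_def by (rule sum.mono_neutral_left) (auto simp: supp_def)

lemma edge_flow_nonneg: "rflow E s t \<phi> \<Longrightarrow> 0 \<le> edge_flow \<phi> e"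
  unfolding edge_flow_def rflow_def by (intro sum_nonneg) auto

lemma edge_flow_pos_iff:
  assumes "rflow E s t \<phi>"
  shows "0 < edge_flow \<phi> e \<longleftrightarrow> (\<exists>p\<in>supp \<phi>. e \<in> set (walk_edges p))"
proof -
  have nn: "\<forall>p\<in>supp \<phi>. 0 \<le> real (count_list (walk_edges p) e) * \<phi> p"
    and fin: "finite (supp \<phi>)"
    using assms by (auto simp: rflow_def)
  have "edge_flow \<phi> e = 0 \<longleftrightarrow> (\<forall>p\<in>supp \<phi>. real (count_list (walk_edges p) e) * \<phi> p = 0)"
    unfolding edge_flow_def using nn fin by (simp add: sum_nonneg_eq_0_iff)
  also have "\<dots> \<longleftrightarrow> (\<forall>p\<in>supp \<phi>. e \<notin> set (walk_edges p))"
    by (auto simp: supp_def count_list_0_iff)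
  finally show ?thesis using edge_flow_nonneg[OF assms, of e] by auto
qed

lemma rflow_pos_iff: "rflow E s t \<phi> \<Longrightarrow> 0 < \<phi> p \<longleftrightarrow> p \<in> supp \<phi>"
  by (auto simp: rflow_def supp_def less_eq_real_def)

lemma rflow_walk: "rflow E s t \<phi> \<Longrightarrow> p \<in> supp \<phi> \<Longrightarrow> p \<in> st_walks E s t"
  by (auto simp: rflow_def)

lemma rflow_value_pos:
  assumes "rflow E s t \<phi>" "0 < \<phi> p"
  shows "0 < rflow_value \<phi>"
  unfolding rflow_value_def
proof (rule sum_pos2[of _ p])
  show "finite (supp \<phi>)" "\<And>i. 0 \<le> \<phi> i" using assms by (auto simp: rflow_def)
qed (use assms in \<open>auto simp: supp_def\<close>)

section \<open>Variational inequality and uniqueness of the equilibrium latency\<close>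

lemma sum_walk_costs:
  assumes "rflow E s t \<phi>" "finite E"
  shows "(\<Sum>p\<in>supp \<phi>. \<phi> p * sum_list (map c (walk_edges p))) = (\<Sum>e\<in>E. c e * edge_flow \<phi> e)"
proof -
  have "(\<Sum>p\<in>supp \<phi>. \<phi> p * sum_list (map c (walk_edges p))) =
    (\<Sum>p\<in>supp \<phi>. \<Sum>e\<in>E. c e * (real (count_list (walk_edges p) e) * \<phi> p))"
  proof (rule sum.cong[OF refl])
    fix p assume "p \<in> supp \<phi>"
    then have "set (walk_edges p) \<subseteq> E" using rflow_walk[OF assms(1)] by (simp add: st_walks_iff)
    then show "\<phi> p * sum_list (map c (walk_edges p)) =
      (\<Sum>e\<in>E. c e * (real (count_list (walk_edges p) e) * \<phi> p))"
      using sum_list_count_list[OF assms(2), of "walk_edges p" c]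
      by (simp add: sum_distrib_left algebra_simps)
  qed
  also have "\<dots> = (\<Sum>e\<in>E. c e * edge_flow \<phi> e)"
    by (subst sum.swap) (simp add: edge_flow_def sum_distrib_left)
  finally show ?thesis .
qed

text \<open>With edge costs frozen at \<phi>, all of \<phi> travels on cheapest walks, of common
  cost \<open>?C\<close>. Any other flow of the same value costs at least r times
  \<open>?C\<close>.\<close>

lemma wardrop_variational_inequality:
  assumes "wardrop E s t r l \<phi>" "0 < \<phi> p" "rflow E s t \<psi>" "rflow_value \<psi> = r" "finite E"
  shows "(\<Sum>e\<in>E. l e (edge_flow \<phi> e) * edge_flow \<phi> e) \<le> (\<Sum>e\<in>E. l e (edge_flow \<phi> e) * edge_flow \<psi> e)"
proof -
  let ?C = "path_latency l \<phi> p"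
  have flow: "rflow E s t \<phi>" "rflow_value \<phi> = r"
    and opt: "\<And>p q. p \<in> st_walks E s t \<Longrightarrow> q \<in> st_walks E s t \<Longrightarrow> 0 < \<phi> p \<Longrightarrow>
      path_latency l \<phi> p \<le> path_latency l \<phi> q"
    using assms(1) by (auto simp: wardrop_def)
  have walk: "q \<in> st_walks E s t" if "q \<in> supp \<phi> \<union> supp \<psi>" for q
    using that flow assms(3) by (auto simp: rflow_def)
  have p: "p \<in> supp \<phi>" using rflow_pos_iff[OF flow(1)] assms(2) by simp
  have "(\<Sum>e\<in>E. l e (edge_flow \<phi> e) * edge_flow \<phi> e) = (\<Sum>q\<in>supp \<phi>. \<phi> q * path_latency l \<phi> q)"
    unfolding path_latency_def by (rule sum_walk_costs[symmetric]) fact+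
  also have "\<dots> \<le> (\<Sum>q\<in>supp \<phi>. \<phi> q * ?C)"
    by (intro sum_mono mult_left_mono opt)
      (use walk p flow rflow_pos_iff[OF flow(1)] in \<open>auto simp: rflow_def\<close>)
  also have "\<dots> = (\<Sum>q\<in>supp \<psi>. \<psi> q * ?C)"
    using flow(2) assms(4) by (simp add: sum_distrib_right[symmetric] rflow_value_def)
  also have "\<dots> \<le> (\<Sum>q\<in>supp \<psi>. \<psi> q * path_latency l \<phi> q)"
    by (intro sum_mono mult_left_mono opt) (use walk p assms in \<open>auto simp: rflow_def\<close>)
  also have "\<dots> = (\<Sum>e\<in>E. l e (edge_flow \<phi> e) * edge_flow \<psi> e)"
    unfolding path_latency_def by (rule sum_walk_costs) fact+
  finally show ?thesis .
qed

text \<open>The two variational inequalities add up to a sum that is at most 0, while monotone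
  latencies make each of its terms nonnegative. So the edge latencies agree even where the edge
  flows differ, and the description in \<open>eq_latency\<close> is well defined.\<close>

lemma wardrop_latency_unique:
  assumes l: "latency_fun E l" and "finite E"
    and \<phi>: "wardrop E s t r l \<phi>" "0 < \<phi> p" and \<psi>: "wardrop E s t r l \<psi>" "0 < \<psi> q"
  shows "path_latency l \<phi> p = path_latency l \<psi> q"
proof -
  let ?f = "edge_flow \<phi>" and ?g = "edge_flow \<psi>"
  have flow: "rflow E s t \<phi>" "rflow_value \<phi> = r" "rflow E s t \<psi>" "rflow_value \<psi> = r"
    using \<phi> \<psi> by (auto simp: wardrop_def)
  have nn: "0 \<le> ?f e" "0 \<le> ?g e" for e using flow by (auto intro: edge_flow_nonneg)
  have mono: "0 \<le> (l e (?f e) - l e (?g e)) * (?f e - ?g e)" if "e \<in> E" for e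
  proof -
    have "mono_on {0..} (l e)" using l that by (auto simp: latency_fun_def)
    then have "?f e \<le> ?g e \<Longrightarrow> l e (?f e) \<le> l e (?g e)" "?g e \<le> ?f e \<Longrightarrow> l e (?g e) \<le> l e (?f e)"
      using nn by (auto simp: mono_on_def)
    then show ?thesis by (cases "?f e \<le> ?g e") (auto simp: mult_nonneg_nonneg mult_nonpos_nonpos)
  qed
  have "(\<Sum>e\<in>E. (l e (?f e) - l e (?g e)) * (?f e - ?g e)) =
    (\<Sum>e\<in>E. l e (?f e) * ?f e) - (\<Sum>e\<in>E. l e (?f e) * ?g e) +
    ((\<Sum>e\<in>E. l e (?g e) * ?g e) - (\<Sum>e\<in>E. l e (?g e) * ?f e))"
    by (simp add: sum_subtractf[symmetric] sum.distrib[symmetric] algebra_simps)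
  also have "\<dots> \<le> 0"
    using wardrop_variational_inequality[OF \<phi> flow(3,4) \<open>finite E\<close>]
      wardrop_variational_inequality[OF \<psi> flow(1,2) \<open>finite E\<close>] by simp
  finally have "(\<Sum>e\<in>E. (l e (?f e) - l e (?g e)) * (?f e - ?g e)) = 0"
    using sum_nonneg[of E "\<lambda>e. (l e (?f e) - l e (?g e)) * (?f e - ?g e)"] mono by simp
  then have "\<forall>e\<in>E. (l e (?f e) - l e (?g e)) * (?f e - ?g e) = 0"
    using mono \<open>finite E\<close> by (simp add: sum_nonneg_eq_0_iff)
  \<comment> \<open>A vanishing product means equal latencies or equal flows, and the latter also
    give equal latencies.\<close>
  then have eq: "l e (?f e) = l e (?g e)" if "e \<in> E" for e
    using that by (metis mult_eq_0_iff right_minus_eq)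
  have same: "path_latency l \<phi> w = path_latency l \<psi> w" if "w \<in> st_walks E s t" for w
    unfolding path_latency_def
    by (rule arg_cong[of _ _ sum_list], rule map_cong[OF refl], rule eq)
      (use that in \<open>auto simp: st_walks_iff\<close>)
  have "p \<in> st_walks E s t" "q \<in> st_walks E s t"
    using rflow_walk flow(1,3) \<phi>(2) \<psi>(2) rflow_pos_iff[OF flow(1)] rflow_pos_iff[OF flow(3)]
    by metis+
  then have "path_latency l \<phi> p \<le> path_latency l \<phi> q" "path_latency l \<psi> q \<le> path_latency l \<psi> p"
    using \<phi> \<psi> by (auto simp: wardrop_def)
  with same \<open>p \<in> _\<close> \<open>q \<in> _\<close> show ?thesis by simp
qed

lemma eq_latency_eqI:
  assumes "latency_fun E l" "finite E" "wardrop E s t r l \<phi>" "0 < \<phi> p"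
  shows "eq_latency E s t r l = path_latency l \<phi> p"
proof -
  have "rflow E s t \<phi>" "rflow_value \<phi> = r" using assms by (auto simp: wardrop_def)
  then have "r \<noteq> 0" using rflow_value_pos[of E s t \<phi> p] assms(4) by auto
  moreover have "(THE c. \<exists>\<phi> p. wardrop E s t r l \<phi> \<and> \<phi> p > 0 \<and> path_latency l \<phi> p = c) =
    path_latency l \<phi> p"
  proof (rule the_equality)
    show "\<exists>\<phi>' p'. wardrop E s t r l \<phi>' \<and> \<phi>' p' > 0 \<and> path_latency l \<phi>' p' = path_latency l \<phi> p"
      using assms(3,4) by blast
    fix c assume "\<exists>\<phi> p. wardrop E s t r l \<phi> \<and> \<phi> p > 0 \<and> path_latency l \<phi> p = c"
    then show "c = path_latency l \<phi> p"
      using wardrop_latency_unique[OF assms(1,2) _ _ assms(3,4)] by blast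
  qed
  ultimately show ?thesis by (simp add: eq_latency_def)
qed

text \<open>The last edge (u, v) of w lies on a used walk q, whose part before v is shortest among
  all walks from s to v.\<close>

lemma used_edges_shortest_walk:
  assumes "wardrop E s t r l \<psi>" "latency_fun E l" "w \<noteq> []" "hd w = s"
    and "\<forall>e\<in>set (walk_edges w). 0 < edge_flow \<psi> e"
    and "w' \<noteq> []" "hd w' = s" "last w' = last w" "set (walk_edges w') \<subseteq> E"
  shows "path_latency l \<psi> w \<le> path_latency l \<psi> w'"
  using assms(3-)
proof (induction w arbitrary: w' rule: rev_nonempty_induct)
  case (single v)
  have "0 \<le> l e (edge_flow \<psi> e)" if "e \<in> E" for e
    using that assms(1,2) edge_flow_nonneg[of E s t \<psi> e] by (simp add: latency_fun_def wardrop_def)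
  then have "\<forall>z\<in>set (map (\<lambda>e. l e (edge_flow \<psi> e)) (walk_edges w')). 0 \<le> z"
    using single.prems(6) by (auto simp del: split_paired_All)
  then have "0 \<le> path_latency l \<psi> w'"
    unfolding path_latency_def by (intro sum_list_nonneg) blast
  then show ?case by (simp add: path_latency_def)
next
  case (snoc v w)
  have flow: "rflow E s t \<psi>" using assms(1) by (simp add: wardrop_def)
  let ?c = "\<lambda>e. l e (edge_flow \<psi> e)"
  define u where "u = last w"
  define w0 where "w0 = butlast w"
  have w: "w = w0 @ [u]" using snoc(1) by (simp add: w0_def u_def)
  have we: "walk_edges (w @ [v]) = walk_edges w @ [(u, v)]"
    using walk_edges_append2[of w0 u v "[]"] w by simp
  then have "0 < edge_flow \<psi> (u, v)" using snoc.prems by auto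
  then obtain q where q: "q \<in> supp \<psi>" "(u, v) \<in> set (walk_edges q)"
    using edge_flow_pos_iff[OF flow] by blast
  then have qw: "q \<in> st_walks E s t" using flow by (auto simp: rflow_def)
  obtain q1 q2 where q12: "q = q1 @ u # v # q2" using q(2) by (auto simp: in_walk_edges_iff)
  define w1 where "w1 = butlast w'"
  have w': "w' = w1 @ [v]" using snoc.prems by (metis append_butlast_last_id last_snoc w1_def)
  let ?r = "w1 @ v # q2"
  have q1e: "walk_edges q = walk_edges (q1 @ [u]) @ (u, v) # walk_edges (v # q2)"
    unfolding q12 by (rule walk_edges_append2)
  have re: "walk_edges ?r = walk_edges w' @ walk_edges (v # q2)"
    unfolding w' by (rule walk_edges_append)
  have "hd ?r = s" using snoc.prems(3) w' snoc.prems by (cases w1) auto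
  moreover have "last ?r = t" using qw by (auto simp: q12 st_walks_iff)
  moreover have "set (walk_edges ?r) \<subseteq> E"
    using re q1e qw snoc.prems(6) by (auto simp: st_walks_iff)
  ultimately have "?r \<in> st_walks E s t" by (simp add: st_walks_iff)
  \<comment> \<open>The used walk q competes with w' continued by the tail of q; the tail common to
    both cancels.\<close>
  then have "path_latency l \<psi> q \<le> path_latency l \<psi> ?r"
    using assms(1) qw q(1) rflow_pos_iff[OF flow] by (auto simp: wardrop_def)
  then have 1: "path_latency l \<psi> (q1 @ [u]) + ?c (u, v) \<le> path_latency l \<psi> w'"
    unfolding path_latency_def q1e re by simp
  have "path_latency l \<psi> w \<le> path_latency l \<psi> (q1 @ [u])"
  proof (rule snoc.IH)
    show "hd w = s" using snoc by (cases w) auto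
    show "\<forall>e\<in>set (walk_edges w). 0 < edge_flow \<psi> e" using snoc.prems we by auto
    show "hd (q1 @ [u]) = s" using qw q12 by (cases q1) (auto simp: st_walks_iff)
    show "set (walk_edges (q1 @ [u])) \<subseteq> E" using qw q1e by (auto simp: st_walks_iff)
  qed (auto simp: u_def)
  with 1 show ?case unfolding path_latency_def we by simp
qed

section \<open>Existence of equilibria\<close>

text \<open>The integral of a nondecreasing function is convex; this is its gradient inequality at
  y, valid on either side of x.\<close>

lemma mono_integral_diff_le:
  fixes h :: "real \<Rightarrow> real"
  assumes cont: "continuous_on {0..} h" and mono: "mono_on {0..} h" and "0 \<le> x" "0 \<le> y"
  shows "integral {0..y} h - integral {0..x} h \<le> h y * (y - x)"
proof -
  have int: "h integrable_on {u..v}" if "0 \<le> u" for u v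
    using that by (intro integrable_continuous_real continuous_on_subset[OF cont]) auto
  show ?thesis
  proof (cases "x \<le> y")
    case True
    have "integral {0..x} h + integral {x..y} h = integral {0..y} h"
      using assms True int by (intro Henstock_Kurzweil_Integration.integral_combine) auto
    moreover have "integral {x..y} h \<le> integral {x..y} (\<lambda>_. h y)"
      using assms int by (intro integral_le) (auto simp: mono_on_def)
    ultimately show ?thesis using True by (simp add: algebra_simps)
  next
    case False
    have "integral {0..y} h + integral {y..x} h = integral {0..x} h"
      using assms False int by (intro Henstock_Kurzweil_Integration.integral_combine) auto
    moreover have "integral {y..x} (\<lambda>_. h y) \<le> integral {y..x} h"
      using assms int by (intro integral_le) (auto simp: mono_on_def)
    ultimately show ?thesis using False by (simp add: algebra_simps)
  qed
qed

text \<open>Tychonoff's theorem on a function type. Flows are functions on all vertex lists, so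
  compactness of the feasible set is taken in the product topology.\<close>

lemma compact_UNIV_Pi:
  fixes S :: "'i \<Rightarrow> 'a::topological_space set"
  assumes "\<And>i. compact (S i)"
  shows "compact {f. \<forall>i. f i \<in> S i}"
proof -
  have "compactin (product_topology (\<lambda>i. euclidean) UNIV) (PiE UNIV S)"
    using assms by (simp add: compactin_PiE)
  moreover have "PiE UNIV S = {f. \<forall>i. f i \<in> S i}" by (auto simp: PiE_def)
  ultimately show ?thesis by (simp add: euclidean_product_topology)
qed

text \<open>The erased edges have nonnegative latency. This extends optimality among simple paths to
  all walks.\<close>

lemma path_latency_loop_erasure:
  assumes "latency_fun E l" "rflow E s t \<phi>" "set (walk_edges p) \<subseteq> E"
    and "mset (walk_edges q) \<subseteq># mset (walk_edges p)"
  shows "path_latency l \<phi> q \<le> path_latency l \<phi> p"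
proof -
  let ?c = "\<lambda>e. l e (edge_flow \<phi> e)"
  obtain M where M: "mset (walk_edges p) = mset (walk_edges q) + M"
    using assms(4) by (metis mset_subset_eq_exists_conv)
  have "e \<in># M \<Longrightarrow> e \<in> set (walk_edges p)" for e
    using M by (metis UnCI set_mset_mset set_mset_union)
  then have "0 \<le> ?c e" if "e \<in># M" for e
    using that assms(1,3) edge_flow_nonneg[OF assms(2)] unfolding latency_fun_def by blast
  then have "0 \<le> sum_mset (image_mset ?c M)" by (induction M) auto
  moreover have "path_latency l \<phi> p = path_latency l \<phi> q + sum_mset (image_mset ?c M)"
  proof -
    have lat: "path_latency l \<phi> w = sum_mset (image_mset ?c (mset (walk_edges w)))" for w
      unfolding path_latency_def by (simp flip: sum_mset_sum_list)
    show ?thesis unfolding lat M by simp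
  qed
  ultimately show ?thesis by simp
qed

text \<open>Minimise the Beckmann potential, the sum over all edges of the integral of the latency from
  0 to the edge flow, over the flows supported on simple paths. Shifting flow between two paths
  does not decrease it; monotonicity and continuity of the latencies turn this into the
  equilibrium condition.\<close>

lemma wardrop_exists:
  assumes G: "st_graph V E s t" and l: "latency_fun E l" and r: "0 \<le> r"
  obtains \<phi> where "wardrop E s t r l \<phi>" "\<forall>p\<in>supp \<phi>. distinct p"
proof -
  define Ps where "Ps = {p \<in> st_walks E s t. distinct p}"
  have "Ps \<subseteq> {p. set p \<subseteq> V \<and> distinct p}"
    unfolding Ps_def using st_walk_vertices[OF G] by blast
  moreover have "finite V" using G by (simp add: st_graph_def)
  ultimately have fin: "finite Ps" using finite_subset_distinct finite_subset by metis
  have finE: "finite E" using st_graph_finite_edges[OF G] .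
  define N where "N p e = real (count_list (walk_edges p) e)" for p :: "'a list" and e
  define F where "F e \<phi> = (\<Sum>p\<in>Ps. N p e * \<phi> p)" for e and \<phi> :: "'a list \<Rightarrow> real"
  \<comment> \<open>Coordinates outside the finite set \<open>Ps\<close> are pinned to 0, so that X
    is a closed part of a product of compact sets.\<close>
  define X where "X = {\<phi>. \<forall>p. \<phi> p \<in> (if p \<in> Ps then {0..r} else {0})} \<inter> {\<phi>. (\<Sum>p\<in>Ps. \<phi> p) = r}"
  define \<Phi> where "\<Phi> \<phi> = (\<Sum>e\<in>E. integral {0..F e \<phi>} (l e))" for \<phi>
  have coord: "continuous_on A (\<lambda>\<phi>. \<phi> p)" for A and p :: "'a list"
    by (rule continuous_on_subset[OF continuous_on_product_coordinates]) simp
  have lc: "continuous_on {0..} (l e)" "mono_on {0..} (l e)" if "e \<in> E" for e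
    using l that by (auto simp: latency_fun_def)
  have "compact X"
    unfolding X_def
  proof (rule compact_Int_closed[OF compact_UNIV_Pi])
    show "closed {\<phi>. (\<Sum>p\<in>Ps. \<phi> p) = r}"
      by (intro closed_Collect_eq continuous_on_sum coord continuous_on_const)
  qed auto
  moreover have "X \<noteq> {}"
  proof -
    obtain p0 where "p0 \<in> st_walks E s t" "distinct p0" using st_graph_obtain_walk[OF G] .
    then have "p0 \<in> Ps" by (simp add: Ps_def)
    then have "(\<lambda>p. if p = p0 then r else 0) \<in> X" using r fin by (auto simp: X_def)
    then show ?thesis by blast
  qed
  moreover have F_nonneg: "0 \<le> F e \<phi>" if "\<phi> \<in> X" for e \<phi>
    unfolding F_def by (intro sum_nonneg mult_nonneg_nonneg)
      (use that in \<open>auto simp: X_def N_def split: if_splits\<close>)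
  moreover have "continuous_on X \<Phi>"
    unfolding \<Phi>_def
  proof (rule continuous_on_sum)
    fix e assume e: "e \<in> E"
    \<comment> \<open>A bound for the flow on e over all of X, so that the indefinite integral is
      needed only on a compact interval.\<close>
    define R where "R = (\<Sum>p\<in>Ps. N p e * r)"
    have "l e integrable_on {0..R}"
      using lc[OF e] by (intro integrable_continuous_real) (auto intro: continuous_on_subset)
    then have "continuous_on {0..R} (\<lambda>z. integral {0..z} (l e))"
      by (rule indefinite_integral_continuous_1)
    moreover have "continuous_on X (F e)"
      unfolding F_def by (intro continuous_intros coord)
    moreover have "F e \<phi> \<le> R" if "\<phi> \<in> X" for \<phi>
      unfolding F_def R_def by (intro sum_mono mult_left_mono)
        (use that in \<open>auto simp: X_def N_def split: if_splits\<close>)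
    then have "F e ` X \<subseteq> {0..R}" using F_nonneg[of _ e] by auto
    ultimately show "continuous_on X (\<lambda>\<phi>. integral {0..F e \<phi>} (l e))"
      by (rule continuous_on_compose2)
  qed
  ultimately obtain \<phi> where \<phi>: "\<phi> \<in> X" and min: "\<And>\<psi>. \<psi> \<in> X \<Longrightarrow> \<Phi> \<phi> \<le> \<Phi> \<psi>"
    using continuous_attains_inf[of X \<Phi>] by metis
  have \<phi>_range: "0 \<le> \<phi> p" "p \<notin> Ps \<Longrightarrow> \<phi> p = 0" for p
    using \<phi> by (auto simp: X_def split: if_splits)
  have supp: "supp \<phi> \<subseteq> Ps" using \<phi>_range by (auto simp: supp_def)
  have flow: "rflow E s t \<phi>"
    unfolding rflow_def using supp fin finite_subset \<phi>_range(1) by (auto simp: Ps_def)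
  have val: "rflow_value \<phi> = r"
    using rflow_value_superset[OF fin supp] \<phi> by (simp add: X_def)
  have F_eq: "F e \<phi> = edge_flow \<phi> e" for e
    using edge_flow_superset[OF fin supp] by (simp add: F_def N_def)
  have simple: "path_latency l \<phi> p \<le> path_latency l \<phi> q"
    if p: "p \<in> Ps" "0 < \<phi> p" and q: "q \<in> Ps" for p q
  proof (cases "p = q")
    case False
    define D where "D e = N q e - N p e" for e
    \<comment> \<open>H \<epsilon> is the slope of the potential \<Phi> after moving \<epsilon>
      units from p to q; its value at 0 is the latency of q minus that of p.\<close>
    define H where "H \<epsilon> = (\<Sum>e\<in>E. l e (F e \<phi> + \<epsilon> * D e) * D e)" for \<epsilon>
    define S where "S \<epsilon> = \<phi>(p := \<phi> p - \<epsilon>, q := \<phi> q + \<epsilon>)" for \<epsilon>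
    have sum_S: "(\<Sum>w\<in>Ps. g w * S \<epsilon> w) = (\<Sum>w\<in>Ps. g w * \<phi> w) + \<epsilon> * (g q - g p)"
      for g :: "'a list \<Rightarrow> real" and \<epsilon>
    proof -
      have "(\<Sum>w\<in>Ps. g w * S \<epsilon> w) =
        (\<Sum>w\<in>Ps. g w * \<phi> w + ((if w = q then \<epsilon> * g w else 0) - (if w = p then \<epsilon> * g w else 0)))"
        using False by (intro sum.cong) (auto simp: S_def algebra_simps)
      also have "\<dots> = (\<Sum>w\<in>Ps. g w * \<phi> w) + \<epsilon> * (g q - g p)"
        using p q fin by (simp add: sum.distrib sum_subtractf algebra_simps)
      finally show ?thesis .
    qed
    have F_S: "F e (S \<epsilon>) = F e \<phi> + \<epsilon> * D e" for e \<epsilon>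
      unfolding F_def D_def using sum_S[of "\<lambda>w. N w e"] by simp
    have S_X: "S \<epsilon> \<in> X" if "0 \<le> \<epsilon>" "\<epsilon> \<le> \<phi> p" for \<epsilon>
    proof -
      have tot: "(\<Sum>w\<in>Ps. S \<epsilon> w) = r" using sum_S[of "\<lambda>_. 1"] \<phi> by (simp add: X_def)
      have nn: "0 \<le> S \<epsilon> w" for w using that \<phi>_range(1) by (auto simp: S_def)
      have "S \<epsilon> w \<le> r" if "w \<in> Ps" for w
        using member_le_sum[of w Ps "S \<epsilon>"] that nn fin tot by auto
      moreover have "S \<epsilon> w = 0" if "w \<notin> Ps" for w
        using that p q \<phi>_range(2)[OF that] by (auto simp: S_def)
      ultimately show ?thesis using tot nn by (auto simp: X_def)
    qed
    have arg_nonneg: "0 \<le> F e \<phi> + \<epsilon> * D e" if "0 \<le> \<epsilon>" "\<epsilon> \<le> \<phi> p" for e \<epsilon>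
      using F_nonneg[OF S_X[OF that]] F_S by simp
    \<comment> \<open>The gradient inequality at the shifted flow bounds the increase of \<Phi> by
      \<epsilon> * H \<epsilon>, so minimality gives the sign without differentiating \<Phi>.
      Continuity of H then carries it to \<epsilon> = 0.\<close>
    have H_nonneg: "0 \<le> H \<epsilon>" if "0 < \<epsilon>" "\<epsilon> < \<phi> p" for \<epsilon>
    proof -
      have \<epsilon>: "0 \<le> \<epsilon>" "\<epsilon> \<le> \<phi> p" using that by auto
      have "0 \<le> \<Phi> (S \<epsilon>) - \<Phi> \<phi>" using min[OF S_X[OF \<epsilon>]] by simp
      also have "\<dots> = (\<Sum>e\<in>E. integral {0..F e \<phi> + \<epsilon> * D e} (l e) - integral {0..F e \<phi>} (l e))"
        by (simp add: \<Phi>_def F_S sum_subtractf)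
      also have "\<dots> \<le> (\<Sum>e\<in>E. l e (F e \<phi> + \<epsilon> * D e) * (F e \<phi> + \<epsilon> * D e - F e \<phi>))"
        using lc F_nonneg[OF \<phi>] arg_nonneg[OF \<epsilon>] by (intro sum_mono mono_integral_diff_le) auto
      also have "\<dots> = \<epsilon> * H \<epsilon>" by (simp add: H_def sum_distrib_left algebra_simps)
      finally show ?thesis using that by (simp add: zero_le_mult_iff)
    qed
    have closure: "closure {0<..<\<phi> p} = {0..\<phi> p}" using p(2) by simp
    have "continuous_on {0..\<phi> p} H"
      unfolding H_def
    proof (intro continuous_on_sum continuous_on_mult continuous_on_const)
      fix e assume "e \<in> E"
      show "continuous_on {0..\<phi> p} (\<lambda>\<epsilon>. l e (F e \<phi> + \<epsilon> * D e))"
        by (rule continuous_on_compose2[OF lc(1)[OF \<open>e \<in> E\<close>]])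
          (use arg_nonneg[of _ e] in \<open>auto intro!: continuous_intros\<close>)
    qed
    then have "0 \<le> H 0"
      using continuous_ge_on_closure[of "{0<..<\<phi> p}" H 0 0] closure p(2) H_nonneg by simp
    moreover have "path_latency l \<phi> w = (\<Sum>e\<in>E. N w e * l e (F e \<phi>))" if "w \<in> Ps" for w
      unfolding path_latency_def F_eq N_def
      by (rule sum_list_count_list[OF finE]) (use that in \<open>simp add: Ps_def st_walks_iff\<close>)
    then have "H 0 = path_latency l \<phi> q - path_latency l \<phi> p"
      using p q by (simp add: H_def D_def sum_subtractf algebra_simps)
    ultimately show ?thesis by simp
  qed simp
  have "wardrop E s t r l \<phi>"
    unfolding wardrop_def
  proof (intro conjI ballI impI flow val)
    fix p q assume "p \<in> st_walks E s t" "q \<in> st_walks E s t" "0 < \<phi> p"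
    then have p: "p \<in> Ps" using \<phi>_range(2)[of p] by force
    obtain q' where q': "distinct q'" "q' \<in> st_walks E s t"
      "mset (walk_edges q') \<subseteq># mset (walk_edges q)"
      using st_walk_loop_erasure[OF \<open>q \<in> st_walks E s t\<close>] by metis
    have "path_latency l \<phi> p \<le> path_latency l \<phi> q'"
      using simple[OF p \<open>0 < \<phi> p\<close>] q' by (simp add: Ps_def)
    also have "\<dots> \<le> path_latency l \<phi> q"
      using path_latency_loop_erasure[OF l flow _ q'(3)] \<open>q \<in> st_walks E s t\<close>
      by (simp add: st_walks_iff)
    finally show "path_latency l \<phi> p \<le> path_latency l \<phi> q" .
  qed
  then show ?thesis using that supp unfolding Ps_def by blast
qed

section \<open>Vulnerability\<close>

lemma sum_edge_flow:
  "(\<Sum>e\<in>K. edge_flow \<phi> e) = (\<Sum>p\<in>supp \<phi>. real (\<Sum>e\<in>K. count_list (walk_edges p) e) * \<phi> p)"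
  unfolding edge_flow_def by (subst sum.swap) (simp add: sum_distrib_right)

lemma obtain_supp:
  assumes "rflow_value \<phi> \<noteq> 0"
  obtains p where "p \<in> supp \<phi>"
  using assms unfolding rflow_value_def by (metis sum.neutral)

text \<open>After loop erasure the walk still has to meet K, so it meets K exactly in (u, v). Being
  simple, it traverses that edge only once, and both remaining parts avoid K.\<close>

lemma obtain_distinct_walk_through_cut_edge:
  assumes hit: "\<forall>w\<in>st_walks D s t. set (walk_edges w) \<inter> K \<noteq> {}"
    and A: "\<exists>w\<in>st_walks D s t. set (walk_edges w) \<inter> K = {(u, v)}"
  obtains A1 A2 where "A1 @ u # v # A2 \<in> st_walks D s t"
    "set (walk_edges (A1 @ [u])) \<inter> K = {}" "set (walk_edges (v # A2)) \<inter> K = {}"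
proof -
  obtain w where w: "w \<in> st_walks D s t" "set (walk_edges w) \<inter> K = {(u, v)}"
    using A by (elim bexE)
  obtain q where q: "distinct q" "q \<in> st_walks D s t" "mset (walk_edges q) \<subseteq># mset (walk_edges w)"
    using st_walk_loop_erasure[OF w(1)] by metis
  have "set (walk_edges q) \<subseteq> set (walk_edges w)" using q(3) by (metis set_mset_mono set_mset_mset)
  then have "set (walk_edges q) \<inter> K \<subseteq> {(u, v)}" using w(2) by blast
  moreover have "set (walk_edges q) \<inter> K \<noteq> {}" using hit q(2) by blast
  ultimately have qK: "set (walk_edges q) \<inter> K = {(u, v)}" by blast
  then obtain A1 A2 where A12: "q = A1 @ u # v # A2"
    using in_walk_edges_iff[of u v q] by blast
  then have we: "walk_edges q = walk_edges (A1 @ [u]) @ (u, v) # walk_edges (v # A2)"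
    by (simp add: walk_edges_append2)
  have "distinct (walk_edges q)" using distinct_walk_edges[OF q(1)] .
  then have "(u, v) \<notin> set (walk_edges (A1 @ [u]))" "(u, v) \<notin> set (walk_edges (v # A2))"
    unfolding we by auto
  moreover have "set (walk_edges (A1 @ [u])) \<subseteq> set (walk_edges q)"
    "set (walk_edges (v # A2)) \<subseteq> set (walk_edges q)"
    unfolding we by auto
  then have "set (walk_edges (A1 @ [u])) \<inter> K \<subseteq> {(u, v)}" "set (walk_edges (v # A2)) \<inter> K \<subseteq> {(u, v)}"
    using qK by blast+
  ultimately show ?thesis using that[of A1 A2] q(2) A12 by blast
qed

text \<open>Compare an equilibrium flow f of the whole graph with an equilibrium flow g of a
  subgraph of smaller latency. Every s-t walk along used edges of g has an edge where f exceeds g,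
  so a minimal cut K consisting of such edges carries more than r of f; hence some path used by f
  passes K twice.\<close>

lemma vulnerable_imp_wheatstone:
  assumes G: "st_graph V E s t" and "vulnerable V E s t"
  shows "has_wheatstone E s t"
proof -
  obtain r l V' E' where r0: "0 \<le> r" and l: "latency_fun E l" and H: "st_subgraph V E V' E' s t"
    and less: "eq_latency E' s t r l < eq_latency E s t r l"
    using assms(2) unfolding vulnerable_def by blast
  have "r \<noteq> 0" using less by (auto simp: eq_latency_def)
  have E': "E' \<subseteq> E" and G': "st_graph V' E' s t" using H by (auto simp: st_subgraph_def)
  have l': "latency_fun E' l" using l E' by (auto simp: latency_fun_def)
  obtain \<phi> where \<phi>: "wardrop E s t r l \<phi>" and dist: "\<And>p. p \<in> supp \<phi> \<Longrightarrow> distinct p"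
    using wardrop_exists[OF G l r0] by metis
  obtain \<psi> where \<psi>: "wardrop E' s t r l \<psi>" using wardrop_exists[OF G' l' r0] .
  have f: "rflow E s t \<phi>" "rflow_value \<phi> = r" and g: "rflow E' s t \<psi>" "rflow_value \<psi> = r"
    using \<phi> \<psi> by (auto simp: wardrop_def)
  obtain p0 where p0: "p0 \<in> supp \<phi>" using obtain_supp[of \<phi>] f \<open>r \<noteq> 0\<close> by auto
  obtain q0 where q0: "q0 \<in> supp \<psi>" using obtain_supp[of \<psi>] g \<open>r \<noteq> 0\<close> by auto
  have p0': "0 < \<phi> p0" "p0 \<in> st_walks E s t"
    using p0 rflow_pos_iff[OF f(1)] rflow_walk[OF f(1)] by auto
  have q0': "0 < \<psi> q0" "q0 \<in> st_walks E' s t"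
    using q0 rflow_pos_iff[OF g(1)] rflow_walk[OF g(1)] by auto
  have lat: "path_latency l \<psi> q0 < path_latency l \<phi> p0"
    using less eq_latency_eqI[OF l st_graph_finite_edges[OF G] \<phi> p0'(1)]
      eq_latency_eqI[OF l' st_graph_finite_edges[OF G'] \<psi> q0'(1)] by simp
  \<comment> \<open>The cut is sought only among the edges used by g, because all s-t walks along
    them have the equilibrium latency of g.\<close>
  define D where "D = {e. 0 < edge_flow \<psi> e}"
  define K0 where "K0 = {e \<in> D. edge_flow \<psi> e < edge_flow \<phi> e}"
  have DE': "D \<subseteq> E'"
  proof
    fix e assume "e \<in> D"
    then obtain p where "p \<in> supp \<psi>" "e \<in> set (walk_edges p)"
      using edge_flow_pos_iff[OF g(1)] by (auto simp: D_def)
    then show "e \<in> E'" using rflow_walk[OF g(1)] by (auto simp: st_walks_iff)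
  qed
  have \<psi>D: "p \<in> st_walks D s t" if "p \<in> supp \<psi>" for p
    using rflow_walk[OF g(1) that] edge_flow_pos_iff[OF g(1)] that
    unfolding st_walks_iff D_def by blast
  have finK0: "finite K0"
    by (rule finite_subset[OF _ st_graph_finite_edges[OF G']]) (use DE' in \<open>auto simp: K0_def\<close>)
  \<comment> \<open>On a walk without an edge where f exceeds g, latencies under f are at most those
    under g. The equilibrium latency of f would then not exceed that of g.\<close>
  have hitK0: "set (walk_edges w) \<inter> K0 \<noteq> {}" if w: "w \<in> st_walks D s t" for w
  proof
    assume none: "set (walk_edges w) \<inter> K0 = {}"
    have wD: "w \<noteq> []" "hd w = s" "last w = t" "set (walk_edges w) \<subseteq> D"
      using w by (auto simp: st_walks_iff)
    have wE: "w \<in> st_walks E s t" using subsetD[OF st_walks_mono[OF order_trans[OF DE' E']] w] .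
    have "path_latency l \<phi> p0 \<le> path_latency l \<phi> w"
      using \<phi> p0' wE by (simp add: wardrop_def)
    also have "\<dots> \<le> path_latency l \<psi> w"
      unfolding path_latency_def
    proof (rule sum_list_mono)
      fix e assume e: "e \<in> set (walk_edges w)"
      then have "edge_flow \<phi> e \<le> edge_flow \<psi> e" "e \<in> E"
        using none wD(4) DE' E' by (auto simp: K0_def)
      then show "l e (edge_flow \<phi> e) \<le> l e (edge_flow \<psi> e)"
        using l edge_flow_nonneg[OF f(1)] edge_flow_nonneg[OF g(1)]
        by (auto simp: latency_fun_def mono_on_def)
    qed
    also have "\<dots> \<le> path_latency l \<psi> q0"
      by (rule used_edges_shortest_walk[OF \<psi> l'])
        (use wD q0' in \<open>auto simp: D_def st_walks_iff\<close>)
    finally show False using lat by simp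
  qed
  obtain K where K: "K \<subseteq> K0"
    and hit: "\<forall>w\<in>st_walks D s t. set (walk_edges w) \<inter> K \<noteq> {}"
    and min: "\<forall>k\<in>K. \<exists>w\<in>st_walks D s t. set (walk_edges w) \<inter> K = {k}"
    using minimal_hitting_set[of K0 "st_walks D s t" "\<lambda>w. set (walk_edges w)", OF finK0 hitK0] by blast
  have finK: "finite K" using K finK0 finite_subset by blast
  \<comment> \<open>Walks of g may be non-simple, but for them only at least one passage of K is
    needed; the bound of one passage concerns the simple paths of f. Strictness on the nonempty K
    gives the contradiction.\<close>
  have "\<exists>p\<in>supp \<phi>. 2 \<le> card (K \<inter> set (walk_edges p))"
  proof (rule ccontr)
    assume none: "\<not> ?thesis"
    have "K \<noteq> {}" using hit \<psi>D[OF q0] by blast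
    have "r \<le> (\<Sum>p\<in>supp \<psi>. real (\<Sum>e\<in>K. count_list (walk_edges p) e) * \<psi> p)"
      unfolding g(2)[symmetric] rflow_value_def
    proof (rule sum_mono)
      fix p assume p: "p \<in> supp \<psi>"
      then obtain e where e: "e \<in> set (walk_edges p)" "e \<in> K" using hit \<psi>D by blast
      have "1 \<le> count_list (walk_edges p) e" using e(1) count_list_0_iff[of "walk_edges p" e] by linarith
      also have "\<dots> \<le> (\<Sum>e\<in>K. count_list (walk_edges p) e)"
        using e(2) finK by (intro member_le_sum) auto
      finally have "1 \<le> real (\<Sum>e\<in>K. count_list (walk_edges p) e)" by linarith
      then show "\<psi> p \<le> real (\<Sum>e\<in>K. count_list (walk_edges p) e) * \<psi> p"
        using p rflow_pos_iff[OF g(1)] mult_right_mono[of 1 _ "\<psi> p"] by simp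
    qed
    also have "\<dots> = (\<Sum>e\<in>K. edge_flow \<psi> e)" by (rule sum_edge_flow[symmetric])
    also have "\<dots> < (\<Sum>e\<in>K. edge_flow \<phi> e)"
      using finK \<open>K \<noteq> {}\<close> K by (intro sum_strict_mono) (auto simp: K0_def)
    also have "\<dots> = (\<Sum>p\<in>supp \<phi>. real (\<Sum>e\<in>K. count_list (walk_edges p) e) * \<phi> p)"
      by (rule sum_edge_flow)
    also have "\<dots> \<le> r"
      unfolding f(2)[symmetric] rflow_value_def
    proof (rule sum_mono)
      fix p assume p: "p \<in> supp \<phi>"
      have "(\<Sum>e\<in>K. count_list (walk_edges p) e) = card (K \<inter> set (walk_edges p))"
        by (rule sum_count_list_distinct[OF distinct_walk_edges[OF dist[OF p]] finK])
      then have "(\<Sum>e\<in>K. count_list (walk_edges p) e) \<le> 1" using none p by force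
      then have "real (\<Sum>e\<in>K. count_list (walk_edges p) e) \<le> 1" by linarith
      then show "real (\<Sum>e\<in>K. count_list (walk_edges p) e) * \<phi> p \<le> \<phi> p"
        using p rflow_pos_iff[OF f(1)] mult_right_mono[of _ 1 "\<phi> p"] by simp
    qed
    finally show False by simp
  qed
  then obtain p where p: "p \<in> supp \<phi>" "2 \<le> card (K \<inter> set (walk_edges p))" by blast
  have pw: "p \<in> st_walks E s t" using rflow_walk[OF f(1) p(1)] .
  obtain m n where mn: "m < n" "n < length (walk_edges p)" "walk_edges p ! m \<in> K"
    "walk_edges p ! n \<in> K"
    using obtain_two_positions[OF p(2)] .
  have len: "Suc n < length p" using mn(2) by (simp add: walk_edges_def)
  have we: "walk_edges p ! i = (p ! i, p ! Suc i)" if "i \<le> n" for i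
    using that len by (simp add: walk_edges_def nth_tl)
  have mK: "(p ! m, p ! Suc m) \<in> K" and nK: "(p ! n, p ! Suc n) \<in> K"
    using mn we[of m] we[of n] by auto
  \<comment> \<open>A is followed from the head of the first cut edge and B up to the tail of the
    second, so neither part contains a cut edge and no splice of them can.\<close>
  obtain A1 A2 where A: "A1 @ p ! m # p ! Suc m # A2 \<in> st_walks D s t"
    "set (walk_edges (p ! Suc m # A2)) \<inter> K = {}"
    using obtain_distinct_walk_through_cut_edge[OF hit bspec[OF min mK]] by metis
  obtain B1 B2 where B: "B1 @ p ! n # p ! Suc n # B2 \<in> st_walks D s t"
    "set (walk_edges (B1 @ [p ! n])) \<inter> K = {}"
    using obtain_distinct_walk_through_cut_edge[OF hit bspec[OF min nK]] by metis
  have eA: "set (walk_edges (p ! Suc m # A2)) \<subseteq> D" "last (p ! Suc m # A2) = t"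
    using A(1) walk_edges_append2[of A1 "p ! m" "p ! Suc m" A2] by (auto simp: st_walks_iff)
  have eB: "set (walk_edges (B1 @ [p ! n])) \<subseteq> D" "hd (B1 @ [p ! n]) = s"
    using B(1) walk_edges_append2[of B1 "p ! n" "p ! Suc n" B2]
    by (auto simp: st_walks_iff hd_append)
  have disj: "set (p ! Suc m # A2) \<inter> set (B1 @ [p ! n]) = {}"
  proof (rule ccontr)
    assume "\<not> ?thesis"
    then obtain v where v: "v \<in> set (p ! Suc m # A2)" "v \<in> set (B1 @ [p ! n])" by blast
    obtain A3 A4 where A34: "p ! Suc m # A2 = A3 @ v # A4" using split_list[OF v(1)] by blast
    obtain B3 B4 where B34: "B1 @ [p ! n] = B3 @ v # B4" using split_list[OF v(2)] by blast
    let ?w = "B3 @ v # A4"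
    have "set (walk_edges (v # A4)) \<subseteq> set (walk_edges (p ! Suc m # A2))"
      unfolding A34 walk_edges_append[of A3 v A4] by simp
    moreover have "set (walk_edges (B3 @ [v])) \<subseteq> set (walk_edges (B1 @ [p ! n]))"
      unfolding B34 walk_edges_append[of B3 v B4] by simp
    moreover have "walk_edges ?w = walk_edges (B3 @ [v]) @ walk_edges (v # A4)"
      by (rule walk_edges_append)
    ultimately have w: "set (walk_edges ?w) \<subseteq> D" "set (walk_edges ?w) \<inter> K = {}"
      using eA(1) eB(1) A(2) B(2) by auto
    have "hd ?w = s" using eB(2) unfolding B34 by (cases B3) auto
    moreover have "last ?w = t" using eA(2) unfolding A34 by simp
    ultimately have "?w \<in> st_walks D s t" using w(1) by (simp add: st_walks_iff)
    then show False using hit w(2) by blast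
  qed
  \<comment> \<open>Were the two cut edges consecutive on p, the middle vertex would lie on both
    walks.\<close>
  then have "Suc m \<noteq> n" by auto
  then have "Suc m < n" using mn(1) by simp
  show ?thesis
    using crossing_imp_wheatstone[OF pw dist[OF p(1)] \<open>Suc m < n\<close>, of "p ! Suc m # A2" "B1 @ [p ! n]"]
      len eA eB disj DE' E' by simp
qed

section \<open>Braess's paradox on a Wheatstone network\<close>

context wheatstone_network
begin

definition potM :: "'v \<Rightarrow> real" where
  "potM v = (if v \<in> N1 then 1 else if v \<in> N2 then 2 else 0)"

definition potAB :: "'v \<Rightarrow> real" where
  "potAB v = (if v = a then 1 / 2 else if v = b then 1 else if v \<in> N2 then 3 / 2 else 0)"

text \<open>Braess's latencies: potM and potAB are the distances from s in the equilibria with and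
  without the middle path from a to b.\<close>

definition lat :: "'v \<times> 'v \<Rightarrow> real \<Rightarrow> real" where
  "lat e z = (if e = edge_a \<or> e = edge_b then z else max 0 (potM (snd e) - potM (fst e)))"

lemma latency_fun_lat: "latency_fun E lat"
proof -
  have "continuous_on {0..} (lat e) \<and> mono_on {0..} (lat e) \<and> (\<forall>z\<ge>0. 0 \<le> lat e z)" for e
    unfolding lat_def by (cases "e = edge_a \<or> e = edge_b") (auto simp: mono_on_def)
  then show ?thesis by (simp add: latency_fun_def)
qed

lemma potM_simps:
  "v \<in> N0 \<Longrightarrow> potM v = 0" "v \<in> N1 \<Longrightarrow> potM v = 1" "v \<in> N2 \<Longrightarrow> potM v = 2"
  "potM a = 1" "potM b = 1"
  using N_disjoint ab_in by (auto simp: potM_def)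

lemma potAB_simps:
  "v \<in> N0 \<Longrightarrow> potAB v = 0" "v \<in> N2 \<Longrightarrow> potAB v = 3 / 2" "potAB a = 1 / 2" "potAB b = 1"
  using N_disjoint ab_in a_neq_b by (auto simp: potAB_def)

text \<open>One unit on \<open>pathM\<close> makes each congestible edge cost 1, its potential
  difference. Every other edge of E costs at least its difference of \<open>potM\<close>, including
  those outside the network, so no walk of G is cheaper than 2.\<close>

lemma eq_latency_M: "eq_latency E s t 1 lat = 2"
proof -
  define \<phi> :: "'v list \<Rightarrow> real" where "\<phi> = (\<lambda>_. 0)(pathM := 1)"
  have supp: "supp \<phi> = {pathM}" by (auto simp: \<phi>_def supp_def)
  have flow: "rflow E s t \<phi>" "rflow_value \<phi> = 1"
    using paths_st_walks(1) by (simp_all add: rflow_def rflow_value_def supp) (auto simp: \<phi>_def)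
  have ef: "edge_flow \<phi> e = real (count_list (walk_edges pathM) e)" for e
    unfolding edge_flow_def supp by (simp add: \<phi>_def)
  let ?c = "\<lambda>e. lat e (edge_flow \<phi> e)"
  have one: "?c e = potM (snd e) - potM (fst e)" if "e = edge_a \<or> e = edge_b" for e
  proof -
    have "e \<in> set (walk_edges pathM)" using that edge_a_in_M edge_b_in_M by auto
    then have "edge_flow \<phi> e = 1"
      unfolding ef using count_list_distinct[OF distinct_walk_edges[OF paths_distinct(1)]] by simp
    then show ?thesis using that edge_a_in edge_b_in by (auto simp: lat_def potM_simps)
  qed
  have ge: "potM v - potM u \<le> ?c (u, v)" for u v
    using one[of "(u, v)"] by (cases "(u, v) = edge_a \<or> (u, v) = edge_b") (auto simp: lat_def)
  have eq: "potM v - potM u = ?c (u, v)" if "(u, v) \<in> set (walk_edges pathM)" for u v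
  proof (cases "(u, v) = edge_a \<or> (u, v) = edge_b")
    case True
    then show ?thesis using one[OF True] by simp
  next
    case False
    then have "potM u = potM v" using edges_M[OF that] by (auto simp: potM_simps)
    then show ?thesis using False by (auto simp: lat_def)
  qed
  have st: "potM t - potM s = 2" using s_in_N0 t_in_N2 by (simp add: potM_simps)
  have M: "path_latency lat \<phi> pathM = 2"
    unfolding path_latency_def
    using sum_list_walk_eq_potential[of pathM potM ?c] eq paths_st_walks(1) st
    by (simp add: st_walks_iff)
  have "2 \<le> path_latency lat \<phi> q" if "q \<in> st_walks E s t" for q
    unfolding path_latency_def
    using sum_list_walk_ge_potential[of q potM ?c] ge that st by (simp add: st_walks_iff)
  then have "wardrop E s t 1 lat \<phi>"
    unfolding wardrop_def using flow M by (auto simp: \<phi>_def)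
  from eq_latency_eqI[OF latency_fun_lat st_graph_finite_edges[OF G] this, of pathM]
  show ?thesis using M by (simp add: \<phi>_def)
qed

text \<open>Without the middle path half a unit goes along each of \<open>pathA\<close> and
  \<open>pathB\<close>: each pays 1/2 on its congestible edge and 1 on its bypass, in total 3/2. On
  this subgraph \<open>potAB\<close> matches the cost of every edge, so all its walks cost the same
  and the equilibrium condition is immediate.\<close>

lemma is_vulnerable: "vulnerable V E s t"
proof -
  define V' where "V' = (\<Union>p\<in>{pathA, pathB}. set p)"
  define E' where "E' = (\<Union>p\<in>{pathA, pathB}. set (walk_edges p))"
  have sub: "st_subgraph V E V' E' s t"
    unfolding V'_def E'_def
    by (rule st_subgraph_Union_walks[OF G]) (use paths_st_walks in auto)
  then have E'E: "E' \<subseteq> E" and G': "st_graph V' E' s t" by (auto simp: st_subgraph_def)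
  define \<psi> :: "'v list \<Rightarrow> real" where "\<psi> = (\<lambda>_. 0)(pathA := 1 / 2, pathB := 1 / 2)"
  have "a \<in> set pathA" by (simp add: pathA_def)
  then have neq: "pathA \<noteq> pathB" using a_notin_B by auto
  have supp: "supp \<psi> = {pathA, pathB}" by (auto simp: \<psi>_def supp_def)
  have walks: "pathA \<in> st_walks E' s t" "pathB \<in> st_walks E' s t"
    using paths_st_walks by (auto simp: E'_def st_walks_iff)
  have flow: "rflow E' s t \<psi>" unfolding rflow_def supp using walks by (auto simp: \<psi>_def)
  have val: "rflow_value \<psi> = 1" unfolding rflow_value_def supp using neq by (simp add: \<psi>_def)
  have ef: "edge_flow \<psi> e =
    (real (count_list (walk_edges pathA) e) + real (count_list (walk_edges pathB) e)) / 2" for e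
    unfolding edge_flow_def supp using neq by (simp add: \<psi>_def)
  \<comment> \<open>Each congestible edge is incident with a vertex that the other path misses, so
    it carries only half a unit.\<close>
  have "edge_a \<notin> set (walk_edges pathB)"
    using walk_edges_subset[of pathB] a_notin_B edge_a_in(2) by (auto simp: edge_a_def)
  then have fa: "edge_flow \<psi> edge_a = 1 / 2"
    unfolding ef using edge_a_in_A paths_distinct(2)
    by (simp add: count_list_distinct distinct_walk_edges)
  have "edge_b \<notin> set (walk_edges pathA)"
    using walk_edges_subset[of pathA] b_notin_A edge_b_in(1) by (auto simp: edge_b_def)
  then have fb: "edge_flow \<psi> edge_b = 1 / 2"
    unfolding ef using edge_b_in_B paths_distinct(3)
    by (simp add: count_list_distinct distinct_walk_edges)
  let ?c = "\<lambda>e. lat e (edge_flow \<psi> e)"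
  have eq: "potAB v - potAB u = ?c (u, v)" if "(u, v) \<in> E'" for u v
  proof (cases "(u, v) = edge_a \<or> (u, v) = edge_b")
    case True
    then have "(u, v) = edge_a \<and> u \<in> N0 \<and> v = a \<or> (u, v) = edge_b \<and> u = b \<and> v \<in> N2"
      using edge_a_in edge_b_in by (metis fst_conv snd_conv)
    then show ?thesis using fa fb by (auto simp: lat_def potAB_simps)
  next
    case False
    then have "u \<in> N0 \<and> v \<in> N0 \<or> u = a \<and> v \<in> N2 \<or> u \<in> N0 \<and> v = b \<or> u \<in> N2 \<and> v \<in> N2"
      using that edges_A[of "(u, v)"] edges_B[of "(u, v)"] unfolding E'_def by auto
    then show ?thesis using False by (auto simp: lat_def potM_simps potAB_simps)
  qed
  have all: "path_latency lat \<psi> q = 3 / 2" if "q \<in> st_walks E' s t" for q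
  proof -
    have "path_latency lat \<psi> q = potAB (last q) - potAB (hd q)"
      unfolding path_latency_def
      by (rule sum_list_walk_eq_potential) (use that eq in \<open>auto simp: st_walks_iff\<close>)
    then show ?thesis using that s_in_N0 t_in_N2 by (simp add: st_walks_iff potAB_simps)
  qed
  have "wardrop E' s t 1 lat \<psi>"
    unfolding wardrop_def by (intro conjI ballI impI flow val) (metis all order_refl)
  moreover have "latency_fun E' lat" using latency_fun_lat E'E by (auto simp: latency_fun_def)
  ultimately have "eq_latency E' s t 1 lat = 3 / 2"
    using eq_latency_eqI[of E' lat s t 1 \<psi> pathA] st_graph_finite_edges[OF G'] all[OF walks(1)]
    by (simp add: \<psi>_def)
  then have "eq_latency E' s t 1 lat < eq_latency E s t 1 lat" using eq_latency_M by simp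
  then show ?thesis
    unfolding vulnerable_def using latency_fun_lat sub by (metis zero_le_one)
qed

end

lemma wheatstone_imp_vulnerable:
  assumes "st_graph V E s t" "has_wheatstone E s t"
  shows "vulnerable V E s t"
proof -
  obtain U1 x U2 a Q b W1 y W2 c d where "wheatstone E s t U1 x U2 a Q b W1 y W2 c d"
    using assms(2) unfolding has_wheatstone_def by blast
  then interpret wheatstone_network V E s t U1 x U2 a Q b W1 y W2 c d
    using assms(1) by unfold_locales
  show ?thesis by (rule is_vulnerable)
qed

theorem theorem8:
  fixes V :: "'v set" and E :: "('v \<times> 'v) set" and s t :: 'v
  assumes "st_graph V E s t"
  shows "vulnerable V E s t \<longleftrightarrow>
           (\<exists>V' E'. st_subgraph V E V' E' s t \<and> acyclic E' \<and> weak E' s t)"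
proof
  assume "vulnerable V E s t"
  then show "\<exists>V' E'. st_subgraph V E V' E' s t \<and> acyclic E' \<and> weak E' s t"
    using vulnerable_imp_wheatstone[OF assms] wheatstone_imp_acyclic_weak_subgraph[OF assms]
    by blast
next
  assume "\<exists>V' E'. st_subgraph V E V' E' s t \<and> acyclic E' \<and> weak E' s t"
  then obtain V' E' where H: "E' \<subseteq> E" "st_graph V' E' s t" "acyclic E'" "weak E' s t"
    unfolding st_subgraph_def by blast
  have "has_wheatstone E s t"
    using has_wheatstone_mono[OF H(1)] weak_acyclic_imp_wheatstone[OF H(2-)] by blast
  then show "vulnerable V E s t" by (rule wheatstone_imp_vulnerable[OF assms])
qed

end
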